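(* Assume that $n\ge3$, $\tau\in\left(0,\frac12\right]$, $\varepsilon\in(0,+\infty)$ and $\mu\in\Gamma_{n-1}$ with $\mu_1\le\mu_2\le\dots\le\mu_n$. Then there exists a positive constant $M$ depending only on $n$, $\tau$, $\varepsilon$ and $\sigma_{n-1}(\mu)$ such that if $\mu_n\ge M$, there holds $$-\sum_{\substack{1\le j,k\le n\\ j\ne k}}\sigma_{n-3}(\mu|jk)w_j\overline w_k-\frac{1-\tau}{\mu_n}\sigma_{n-2}(\mu|n)|w_n|^2\ \ge\ -\frac{n^2}{\sigma_{n-1}(\mu)}\Bigl|\sum_{j=1}^n\sigma_{n-2}(\mu|j)w_j\Bigr|^2-(1-\tau)\sum_{j=1}^{n-1}\frac{\sigma_{n-2}(\mu|j)|w_j|^2}{\mu_n+\varepsilon-\mu_j}$$ for any $w=(w_1,\dots,w_n)^T\in\mathbb C^n$.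
   Context: For $\mu=(\mu_1,\dots,\mu_n)^T\in\mathbb R^n$: $\sigma_0=1$, $\sigma_q(\mu)=\sum_{1\le j_1<\dots<j_q\le n}\mu_{j_1}\cdots\mu_{j_q}$ for $1\le q\le n$; $\Gamma_{n-1}=\{\mu\in\mathbb R^n:\sigma_q(\mu)>0\ \forall q\in\{1,\dots,n-1\}\}$. $\sigma_q(\mu|j)=\partial\sigma_{q+1}(\mu)/\partial\mu_j$, i.e. $\sigma_q$ of $\mu$ with the entry $\mu_j$ set to $0$; $\sigma_q(\mu|jk)=\partial^2\sigma_{q+2}(\mu)/\partial\mu_k\partial\mu_j$, i.e., for $j\ne k$, $\sigma_q$ of $\mu$ with $\mu_j$ and $\mu_k$ set to $0$. "Depending only on $n,\tau,\varepsilon,\sigma_{n-1}(\mu)$" means that the same $M$ serves for all such $\mu$ with the same value of $\sigma_{n-1}(\mu)$. *)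

theory Defs
  imports Complex_Main
begin

text \<open>
  Vectors in \<open>\<real>\<^sup>n\<close> and \<open>\<complex>\<^sup>n\<close> are functions on \<open>nat\<close> of which only the entries with indices in
  \<open>{1..n}\<close> are ever used.
\<close>

definition sigma :: "nat \<Rightarrow> nat \<Rightarrow> (nat \<Rightarrow> real) \<Rightarrow> real" where
  "sigma n q \<mu> = (\<Sum>S | S \<subseteq> {1..n} \<and> card S = q. \<Prod>j\<in>S. \<mu> j)"

definition Gamma_cone :: "nat \<Rightarrow> nat \<Rightarrow> (nat \<Rightarrow> real) set" where
  "Gamma_cone n m = {\<mu>. \<forall>q\<in>{1..m}. sigma n q \<mu> > 0}"

text \<open>
  \<open>sigma_del n q \<mu> j\<close> is \<open>\<sigma>\<^sub>q(\<mu>|j)\<close>, and \<open>sigma_del2 n q \<mu> j k\<close> is \<open>\<sigma>\<^sub>q(\<mu>|jk)\<close> for \<open>j \<noteq> k\<close>. That these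
  are the partial derivatives of \<open>\<sigma>\<^sub>q\<^sub>+\<^sub>1\<close> and \<open>\<sigma>\<^sub>q\<^sub>+\<^sub>2\<close> is shown below. For \<open>j = k\<close> the value of
  \<open>sigma_del2\<close> is not meant to be used (there the second derivative would be \<open>0\<close>).
\<close>

definition sigma_del :: "nat \<Rightarrow> nat \<Rightarrow> (nat \<Rightarrow> real) \<Rightarrow> nat \<Rightarrow> real" where
  "sigma_del n q \<mu> j = sigma n q (\<mu>(j := 0))"

definition sigma_del2 :: "nat \<Rightarrow> nat \<Rightarrow> (nat \<Rightarrow> real) \<Rightarrow> nat \<Rightarrow> nat \<Rightarrow> real" where
  "sigma_del2 n q \<mu> j k = sigma n q (\<mu>(j := 0, k := 0))"

lemma sigma_0: "sigma n 0 \<mu> = 1"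
proof -
  have "{S. S \<subseteq> {1..n} \<and> card S = 0} = {{}}"
    by (auto dest: finite_subset)
  then show ?thesis
    by (simp add: sigma_def)
qed

lemma sigma_upd:
  assumes j: "j \<in> {1..n}"
  shows "sigma n (Suc q) (\<mu>(j := t)) = t * sigma_del n q \<mu> j + sigma_del n (Suc q) \<mu> j"
proof -
  let ?N = "{1..n}"
  let ?F = "\<lambda>q. {S. S \<subseteq> ?N - {j} \<and> card S = q}"
  have fin: "finite S" if "S \<subseteq> ?N" for S
    using that finite_subset by blast
  have finF: "finite (?F r)" for r
    by (rule finite_subset[of _ "Pow ?N"]) auto
  have ins: "S \<in> insert j ` ?F q" if "S \<subseteq> ?N" "card S = Suc q" "j \<in> S" for S
    using that fin[of S] by (intro image_eqI[of _ _ "S - {j}"]) auto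
  have ci: "card (insert j S) = Suc (card S)" if "S \<subseteq> ?N - {j}" for S
    using that fin[of S] by (subst card_insert_disjoint) auto
  have split: "{S. S \<subseteq> ?N \<and> card S = Suc q} = insert j ` ?F q \<union> ?F (Suc q)" for q
  proof (intro equalityI subsetI)
    fix S assume S: "S \<in> {S. S \<subseteq> ?N \<and> card S = Suc q}"
    show "S \<in> insert j ` ?F q \<union> ?F (Suc q)"
    proof (cases "j \<in> S")
      case True
      have "S = insert j (S - {j})" "S - {j} \<in> ?F q"
        using S True fin[of S] by auto
      then show ?thesis by blast
    qed (use S in auto)
  next
    fix S assume "S \<in> insert j ` ?F q \<union> ?F (Suc q)"
    then show "S \<in> {S. S \<subseteq> ?N \<and> card S = Suc q}"
      using j ci by auto
  qed
  have inj: "inj_on (insert j) (?F q)" for q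
    by (rule inj_onI) (metis (mono_tags, lifting) Diff_insert_absorb insert_Diff1 mem_Collect_eq
        singletonI subset_Diff_insert)
  have same: "(\<Prod>i\<in>S. (\<mu>(j := s)) i) = (\<Prod>i\<in>S. \<mu> i)" if "S \<subseteq> ?N - {j}" for S s
    using that by (intro prod.cong) auto
  have pins: "(\<Prod>i\<in>insert j S. (\<mu>(j := s)) i) = s * (\<Prod>i\<in>S. \<mu> i)" if "S \<subseteq> ?N - {j}" for S s
    using that fin[of S] same[OF that, of s] by (subst prod.insert) auto
  have S1: "sigma n (Suc q) (\<mu>(j := s))
      = s * (\<Sum>S\<in>?F q. \<Prod>i\<in>S. \<mu> i) + (\<Sum>S\<in>?F (Suc q). \<Prod>i\<in>S. \<mu> i)" for q s
  proof -
    have "sigma n (Suc q) (\<mu>(j := s)) = (\<Sum>S\<in>insert j ` ?F q. \<Prod>i\<in>S. (\<mu>(j := s)) i)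
        + (\<Sum>S\<in>?F (Suc q). \<Prod>i\<in>S. (\<mu>(j := s)) i)"
      unfolding sigma_def split by (rule sum.union_disjoint) (use finF in auto)
    also have "(\<Sum>S\<in>insert j ` ?F q. \<Prod>i\<in>S. (\<mu>(j := s)) i) = (\<Sum>S\<in>?F q. s * (\<Prod>i\<in>S. \<mu> i))"
      using pins by (subst sum.reindex[OF inj]) (auto intro!: sum.cong simp del: fun_upd_apply)
    also have "(\<Sum>S\<in>?F (Suc q). \<Prod>i\<in>S. (\<mu>(j := s)) i) = (\<Sum>S\<in>?F (Suc q). \<Prod>i\<in>S. \<mu> i)"
      using same by (intro sum.cong) auto
    finally show ?thesis by (simp add: sum_distrib_left fun_upd_def)
  qed
  have del: "sigma_del n r \<mu> j = (\<Sum>S\<in>?F r. \<Prod>i\<in>S. \<mu> i)" for r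
  proof (cases r)
    case 0
    have "?F 0 = {{}}"
      by (auto dest: finite_subset)
    then show ?thesis
      by (simp add: 0 sigma_del_def sigma_0)
  next
    case (Suc p)
    show ?thesis
      unfolding sigma_del_def Suc S1 by simp
  qed
  show ?thesis
    unfolding S1 del ..
qed

lemma sigma_del_derivative:
  assumes "j \<in> {1..n}"
  shows "((\<lambda>t. sigma n (q + 1) (\<mu>(j := t))) has_real_derivative sigma_del n q \<mu> j) (at (\<mu> j))"
  using assms by (auto simp: sigma_upd intro!: derivative_eq_intros)

lemma sigma_del2_derivative:
  assumes "j \<in> {1..n}" "k \<in> {1..n}" "j \<noteq> k"
  shows "((\<lambda>t. sigma_del n (q + 1) (\<mu>(k := t)) j) has_real_derivative sigma_del2 n q \<mu> j k) (at (\<mu> k))"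
proof -
  have "(\<lambda>t. sigma_del n (q + 1) (\<mu>(k := t)) j) = (\<lambda>t. sigma n (q + 1) ((\<mu>(j := 0))(k := t)))"
    using assms by (simp add: sigma_del_def fun_upd_twist)
  moreover have "sigma_del2 n q \<mu> j k = sigma_del n q (\<mu>(j := 0)) k"
    by (simp add: sigma_del2_def sigma_del_def)
  ultimately show ?thesis
    using sigma_del_derivative[OF assms(2), of q "\<mu>(j := 0)"] assms by simp
qed

text \<open>
  The Hermitian form below is real, so taking its real part in an inequality loses nothing.
\<close>

lemma hermitian_form_real:
  "(\<Sum>j=1..n. \<Sum>k\<in>{1..n} - {j}. of_real (sigma_del2 n q \<mu> j k) * w j * cnj (w k)) \<in> \<real>"
proof -
  let ?f = "\<lambda>j k. of_real (sigma_del2 n q \<mu> j k) * w j * cnj (w k)"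
  have sym: "sigma_del2 n q \<mu> j k = sigma_del2 n q \<mu> k j" for j k
    by (cases "j = k") (simp_all add: sigma_del2_def fun_upd_twist)
  have eq: "(\<Sum>j=1..n. \<Sum>k\<in>{1..n} - {j}. g j k) = (\<Sum>j=1..n. \<Sum>k=1..n. if j = k then 0 else g j k)"
    for g :: "nat \<Rightarrow> nat \<Rightarrow> complex"
    by (intro sum.cong refl sum.mono_neutral_cong_left) auto
  have "cnj (\<Sum>j=1..n. \<Sum>k\<in>{1..n} - {j}. ?f j k) = (\<Sum>j=1..n. \<Sum>k\<in>{1..n} - {j}. ?f k j)"
    by (simp add: sym mult_ac)
  also have "\<dots> = (\<Sum>j=1..n. \<Sum>k\<in>{1..n} - {j}. ?f j k)"
    unfolding eq by (subst sum.swap) (intro sum.cong refl, auto)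
  finally show ?thesis
    by (simp only: Reals_cnj_iff)
qed

end

theory Submission
  imports Defs "HOL-Analysis.Convex"
begin

text \<open>
  The cone condition with the ordering forces \<open>\<mu>\<^sub>2 > 0\<close> (\<open>Gamma_cone_second_pos\<close>), so that only
  \<open>\<mu>\<^sub>1\<close> can be nonpositive. Put \<open>Q = \<mu>\<^sub>2 \<cdots> \<mu>\<^sub>n\<close>, \<open>t = \<Sum>\<^sub>j\<^sub>\<ge>\<^sub>2 1/\<mu>\<^sub>j\<close>, \<open>p\<^sub>j = 1/(t \<mu>\<^sub>j)\<close>, so
  that \<open>p\<close> is a probability vector on \<open>{2..n}\<close> with largest entry \<open>p\<^sub>2\<close> and smallest entry \<open>p\<^sub>n\<close>, and
  \<open>b = 1 + \<mu>\<^sub>1 t\<close>. Then \<open>\<sigma>\<^sub>n\<^sub>-\<^sub>1(\<mu>) = Q b\<close>, and after the substitution \<open>X = t w\<^sub>1\<close>,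
  \<open>v\<^sub>j = w\<^sub>j/\<mu>\<^sub>j\<close> the common factor \<open>Q\<close> cancels and only \<open>b\<close>, \<open>p\<close> and \<open>\<epsilon>/\<mu>\<^sub>n\<close> are left.
  All coefficients are real, so it suffices to treat the real and the imaginary part of \<open>w\<close>
  separately.

  Keep one of the \<open>n\<^sup>2\<close> copies of \<open>|\<Sum>\<^sub>j \<sigma>\<^sub>n\<^sub>-\<^sub>2(\<mu>|j) w\<^sub>j|\<^sup>2 / \<sigma>\<^sub>n\<^sub>-\<^sub>1(\<mu>)\<close>. With the mean
  \<open>E = \<Sum> p\<^sub>j v\<^sub>j\<close> the square combines with the off-diagonal sum to
  \<open>(X + E)\<^sup>2/b + (b - 2) E\<^sup>2 + \<Sum> (b - 2 (b - 1) p\<^sub>j) v\<^sub>j\<^sup>2\<close>, which is the familiar concavity of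
  \<open>log \<sigma>\<^sub>n\<^sub>-\<^sub>1\<close>. What has to be absorbed is \<open>-(1 - \<tau>) (b - (b - 1) p\<^sub>n) v\<^sub>n\<^sup>2\<close>, with the help of
  the diagonal terms. This is \<open>normalized_form_nonneg\<close>; once \<open>X\<close> has been eliminated, the form is affine
  in \<open>b\<close>, so that it is enough to look at a few values of \<open>b\<close>.

  \<^item> At \<open>b = 0\<close> the form is twice the \<open>p\<close>-variance of \<open>v\<close> plus \<open>1 - \<tau>\<close> times a multiple of \<open>p\<^sub>n\<close>. It is
  nonnegative, with a margin proportional to \<open>p\<^sub>n v\<^sub>n\<^sup>2\<close> (\<open>variance_form_ge\<close>). This is the delicate
  estimate: for \<open>\<tau> = 0\<close> no margin would be left as \<open>p\<^sub>2 \<rightarrow> 1\<close>. It uses the terms of \<open>w\<^sub>1\<close>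
  and \<open>w\<^sub>2\<close> in the last sum of the theorem.

  \<^item> At \<open>b = 1\<close> the claim follows from \<open>E\<^sup>2 \<le> \<Sum> v\<^sub>j\<^sup>2 - (1 - \<tau>) v\<^sub>n\<^sup>2\<close>, which holds if
  \<open>p\<^sub>n \<le> \<tau> p\<^sub>2\<close> (\<open>square_mean_le_defective\<close>).

  \<^item> Since \<open>\<mu>\<^sub>1 \<le> \<mu>\<^sub>2\<close>, the largest possible value is \<open>b = 1 + 1/p\<^sub>2\<close>, and there every coefficient
  is nonnegative if \<open>p\<^sub>n \<le> \<tau> p\<^sub>2\<close>.

  It remains to handle \<open>p\<^sub>n > \<tau> p\<^sub>2\<close>, that is \<open>\<mu>\<^sub>2 > \<tau> \<mu>\<^sub>n\<close>. Then all of \<open>\<mu>\<^sub>2, \<dots>, \<mu>\<^sub>n\<close> are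
  large, and \<open>b = \<sigma>\<^sub>n\<^sub>-\<^sub>1(\<mu>)/Q\<close> is as small as desired because \<open>\<sigma>\<^sub>n\<^sub>-\<^sub>1(\<mu>)\<close> is prescribed; the margin
  at \<open>b = 0\<close> then wins (\<open>second_entry_small_or_b_small\<close>, \<open>form_nonneg_b_le_1\<close>). The number \<open>\<epsilon>\<close> enters only
  through \<open>\<eta> = \<epsilon>/\<mu>\<^sub>n\<close>, which is small compared with \<open>\<tau>\<close> for large \<open>\<mu>\<^sub>n\<close>.
\<close>

section \<open>Elementary symmetric functions of nearly full degree\<close>

text \<open>
  Every \<open>\<sigma>\<close> in the theorem has degree one less than the number of entries that have not been set to
  \<open>0\<close>, and the subsets of \<open>A\<close> with one element less than \<open>A\<close> are the sets \<open>A - {i}\<close>.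
\<close>

lemma sigma_support_card_Suc:
  assumes "A \<subseteq> {1..n}" "card A = Suc q" "\<And>i. i \<in> {1..n} - A \<Longrightarrow> \<nu> i = 0"
  shows "sigma n q \<nu> = (\<Sum>i\<in>A. \<Prod>j\<in>A - {i}. \<nu> j)"
proof -
  have fin: "finite A" using assms(1) finite_subset by blast
  have img: "{S. S \<subseteq> A \<and> card S = q} = (\<lambda>i. A - {i}) ` A"
  proof (intro equalityI subsetI)
    fix S assume "S \<in> {S. S \<subseteq> A \<and> card S = q}"
    then have S: "S \<subseteq> A" "card S = q" by auto
    have "card (A - S) = 1"
      using S fin assms(2) by (simp add: card_Diff_subset finite_subset)
    then obtain i where "A - S = {i}" by (auto simp: card_1_singleton_iff)
    then show "S \<in> (\<lambda>i. A - {i}) ` A" using S by (intro image_eqI[of _ _ i]) auto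
  next
    fix S assume "S \<in> (\<lambda>i. A - {i}) ` A"
    then show "S \<in> {S. S \<subseteq> A \<and> card S = q}" using fin assms(2) by auto
  qed
  have "sigma n q \<nu> = (\<Sum>S | S \<subseteq> A \<and> card S = q. \<Prod>j\<in>S. \<nu> j)"
    unfolding sigma_def
  proof (rule sum.mono_neutral_right)
    show "finite {S. S \<subseteq> {1..n} \<and> card S = q}" by simp
    show "{S. S \<subseteq> A \<and> card S = q} \<subseteq> {S. S \<subseteq> {1..n} \<and> card S = q}" using assms(1) by auto
    show "\<forall>S\<in>{S. S \<subseteq> {1..n} \<and> card S = q} - {S. S \<subseteq> A \<and> card S = q}. (\<Prod>j\<in>S. \<nu> j) = 0"
    proof
      fix S assume "S \<in> {S. S \<subseteq> {1..n} \<and> card S = q} - {S. S \<subseteq> A \<and> card S = q}"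
      then obtain i where "i \<in> S" "i \<in> {1..n} - A" "finite S"
        using finite_subset[of S "{1..n}"] by blast
      then show "(\<Prod>j\<in>S. \<nu> j) = 0" using assms(3) by (intro prod_zero) auto
    qed
  qed
  also have "\<dots> = (\<Sum>i\<in>A. \<Prod>j\<in>A - {i}. \<nu> j)"
    unfolding img by (subst sum.reindex) (auto intro!: inj_onI)
  finally show ?thesis .
qed

lemma sum_prod_Diff_singleton:
  fixes \<nu> :: "'a \<Rightarrow> real"
  assumes "finite B" "\<And>i. i \<in> B \<Longrightarrow> \<nu> i \<noteq> 0"
  shows "(\<Sum>i\<in>B. \<Prod>j\<in>B - {i}. \<nu> j) = (\<Prod>j\<in>B. \<nu> j) * (\<Sum>i\<in>B. 1 / \<nu> i)"
  using assms by (auto simp: sum_distrib_left prod_diff1 intro!: sum.cong)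

text \<open>
  Only the entries on \<open>B\<close> are inverted, so that the formula remains valid when \<open>\<nu> a = 0\<close>. It is applied
  with \<open>a = 1\<close>, since \<open>\<mu>\<^sub>1\<close> may vanish.
\<close>

lemma sum_prod_Diff_singleton_insert:
  fixes \<nu> :: "'a \<Rightarrow> real"
  assumes "finite B" "a \<notin> B" "\<And>i. i \<in> B \<Longrightarrow> \<nu> i \<noteq> 0"
  shows "(\<Sum>i\<in>insert a B. \<Prod>j\<in>insert a B - {i}. \<nu> j)
    = (\<Prod>j\<in>B. \<nu> j) * (1 + \<nu> a * (\<Sum>i\<in>B. 1 / \<nu> i))"
proof -
  have "(\<Prod>j\<in>insert a B - {i}. \<nu> j) = \<nu> a * (\<Prod>j\<in>B - {i}. \<nu> j)" if "i \<in> B" for i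
  proof -
    have "insert a B - {i} = insert a (B - {i})" using that assms(2) by auto
    then show ?thesis using assms by simp
  qed
  then have "(\<Sum>i\<in>B. \<Prod>j\<in>insert a B - {i}. \<nu> j) = \<nu> a * (\<Sum>i\<in>B. \<Prod>j\<in>B - {i}. \<nu> j)"
    by (simp add: sum_distrib_left)
  moreover have "insert a B - {a} = B" using assms(2) by auto
  ultimately show ?thesis
    using assms by (simp add: sum_prod_Diff_singleton algebra_simps)
qed

lemma sigma_pred_eq:
  assumes "n \<ge> 2" and nz: "\<And>j. j \<in> {2..n} \<Longrightarrow> \<mu> j \<noteq> 0"
  shows "sigma n (n - 1) \<mu> = (\<Prod>j\<in>{2..n}. \<mu> j) * (1 + \<mu> 1 * (\<Sum>j\<in>{2..n}. 1 / \<mu> j))"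
proof -
  have A: "{1..n} = insert 1 {2..n}" using assms(1) by auto
  have "sigma n (n - 1) \<mu> = (\<Sum>i\<in>{1..n}. \<Prod>j\<in>{1..n} - {i}. \<mu> j)"
    using assms(1) by (intro sigma_support_card_Suc) auto
  then show ?thesis unfolding A
    using nz by (subst (asm) sum_prod_Diff_singleton_insert) auto
qed

lemma sigma_del_first_eq:
  assumes "n \<ge> 2" and nz: "\<And>j. j \<in> {2..n} \<Longrightarrow> \<mu> j \<noteq> 0"
  shows "sigma_del n (n - 2) \<mu> 1 = (\<Prod>j\<in>{2..n}. \<mu> j) * (\<Sum>j\<in>{2..n}. 1 / \<mu> j)"
proof -
  have "sigma_del n (n - 2) \<mu> 1 = (\<Sum>i\<in>{2..n}. \<Prod>j\<in>{2..n} - {i}. (\<mu>(1 := 0)) j)"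
    unfolding sigma_del_def using assms(1) by (intro sigma_support_card_Suc) auto
  also have "\<dots> = (\<Sum>i\<in>{2..n}. \<Prod>j\<in>{2..n} - {i}. \<mu> j)"
    by (intro sum.cong prod.cong) auto
  finally show ?thesis using nz by (subst (asm) sum_prod_Diff_singleton) auto
qed

lemma sigma_del_eq:
  assumes j: "j \<in> {2..n}" and nz: "\<And>j. j \<in> {2..n} \<Longrightarrow> \<mu> j \<noteq> 0"
  shows "sigma_del n (n - 2) \<mu> j
    = (\<Prod>i\<in>{2..n}. \<mu> i) / \<mu> j * (1 + \<mu> 1 * ((\<Sum>i\<in>{2..n}. 1 / \<mu> i) - 1 / \<mu> j))"
proof -
  let ?B = "{2..n} - {j}"
  have "sigma_del n (n - 2) \<mu> j
      = (\<Sum>i\<in>insert 1 ?B. \<Prod>k\<in>insert 1 ?B - {i}. (\<mu>(j := 0)) k)"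
    unfolding sigma_del_def using j by (intro sigma_support_card_Suc) auto
  also have "\<dots> = (\<Sum>i\<in>insert 1 ?B. \<Prod>k\<in>insert 1 ?B - {i}. \<mu> k)"
    using j by (intro sum.cong prod.cong) auto
  also have "\<dots> = (\<Prod>i\<in>?B. \<mu> i) * (1 + \<mu> 1 * (\<Sum>i\<in>?B. 1 / \<mu> i))"
    using nz by (intro sum_prod_Diff_singleton_insert) auto
  finally show ?thesis using j nz by (simp add: prod_diff1 sum_diff1)
qed

lemma sigma_del2_first_eq:
  assumes k: "k \<in> {2..n}" and n: "n \<ge> 3" and nz: "\<And>j. j \<in> {2..n} \<Longrightarrow> \<mu> j \<noteq> 0"
  shows "sigma_del2 n (n - 3) \<mu> 1 k
    = (\<Prod>i\<in>{2..n}. \<mu> i) / \<mu> k * ((\<Sum>i\<in>{2..n}. 1 / \<mu> i) - 1 / \<mu> k)"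
proof -
  let ?B = "{2..n} - {k}"
  have "sigma_del2 n (n - 3) \<mu> 1 k
      = (\<Sum>i\<in>?B. \<Prod>l\<in>?B - {i}. (\<mu>(1 := 0, k := 0)) l)"
    unfolding sigma_del2_def using k n by (intro sigma_support_card_Suc) auto
  also have "\<dots> = (\<Sum>i\<in>?B. \<Prod>l\<in>?B - {i}. \<mu> l)"
    using k by (intro sum.cong prod.cong) auto
  also have "\<dots> = (\<Prod>i\<in>?B. \<mu> i) * (\<Sum>i\<in>?B. 1 / \<mu> i)"
    using nz by (intro sum_prod_Diff_singleton) auto
  finally show ?thesis using k nz by (simp add: prod_diff1 sum_diff1)
qed

lemma sigma_del2_eq:
  assumes jk: "j \<in> {2..n}" "k \<in> {2..n}" "j \<noteq> k" and nz: "\<And>j. j \<in> {2..n} \<Longrightarrow> \<mu> j \<noteq> 0"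
  shows "sigma_del2 n (n - 3) \<mu> j k = (\<Prod>i\<in>{2..n}. \<mu> i) / (\<mu> j * \<mu> k)
    * (1 + \<mu> 1 * ((\<Sum>i\<in>{2..n}. 1 / \<mu> i) - 1 / \<mu> j - 1 / \<mu> k))"
proof -
  let ?B = "{2..n} - {j} - {k}"
  have "card ?B = n - 3" using jk by simp
  then have "sigma_del2 n (n - 3) \<mu> j k
      = (\<Sum>i\<in>insert 1 ?B. \<Prod>l\<in>insert 1 ?B - {i}. (\<mu>(j := 0, k := 0)) l)"
    unfolding sigma_del2_def using jk by (intro sigma_support_card_Suc) auto
  also have "\<dots> = (\<Sum>i\<in>insert 1 ?B. \<Prod>l\<in>insert 1 ?B - {i}. \<mu> l)"
    using jk by (intro sum.cong prod.cong) auto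
  also have "\<dots> = (\<Prod>i\<in>?B. \<mu> i) * (1 + \<mu> 1 * (\<Sum>i\<in>?B. 1 / \<mu> i))"
    using nz by (intro sum_prod_Diff_singleton_insert) auto
  finally show ?thesis using jk nz by (simp add: prod_diff1 sum_diff1)
qed

section \<open>Positivity of all entries but the first\<close>

lemma prod_shift_eq_sum_sigma:
  "(\<Prod>j\<in>{1..n}. \<mu> j + z) = (\<Sum>q\<le>n. sigma n q \<mu> * z ^ (n - q))"
proof -
  have "(\<Prod>j\<in>{1..n}. \<mu> j + z) = (\<Sum>X\<in>Pow {1..n}. (\<Prod>j\<in>X. \<mu> j) * z ^ (n - card X))"
    by (subst prod_add) (auto intro!: sum.cong simp: card_Diff_subset finite_subset)
  also have "\<dots> = (\<Sum>q\<le>n. \<Sum>X | X \<in> Pow {1..n} \<and> card X = q. (\<Prod>j\<in>X. \<mu> j) * z ^ (n - card X))"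
    by (rule sum.group[symmetric]) (auto dest: card_mono[rotated])
  also have "\<dots> = (\<Sum>q\<le>n. sigma n q \<mu> * z ^ (n - q))"
    unfolding sigma_def sum_distrib_right by (intro sum.cong) auto
  finally show ?thesis .
qed

text \<open>
  Consider \<open>f z = \<Prod> (\<mu>\<^sub>j + z) = \<Sum> \<sigma>\<^sub>q z\<^bsup>n-q\<^esup>\<close>. In \<open>\<Gamma>\<^sub>n\<^sub>-\<^sub>1\<close> all of its coefficients except
  possibly the constant one are positive, so \<open>f' > 0\<close> on \<open>[0, \<infinity>)\<close>. If \<open>\<mu>\<^sub>2 \<le> 0\<close>, then \<open>r = -\<mu>\<^sub>2 \<ge> 0\<close> is
  a root of \<open>f\<close>, and \<open>f' r = \<Prod>\<^sub>j\<^sub>\<noteq>\<^sub>2 (\<mu>\<^sub>j - \<mu>\<^sub>2)\<close>. Here the factor with \<open>j = 1\<close> is \<open>\<le> 0\<close> and the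
  others are \<open>\<ge> 0\<close>, a contradiction.
\<close>

lemma Gamma_cone_second_pos:
  assumes n: "n \<ge> 2" and G: "\<mu> \<in> Gamma_cone n (n - 1)" and mono: "mono_on {1..n} \<mu>"
  shows "\<mu> 2 > 0"
proof (rule ccontr)
  assume "\<not> \<mu> 2 > 0"
  define r where "r = - \<mu> 2"
  have r: "r \<ge> 0" using \<open>\<not> \<mu> 2 > 0\<close> by (simp add: r_def)
  define h where "h = (\<lambda>z. \<Prod>j\<in>{1..n} - {2}. \<mu> j + z)"
  define D where "D = (\<Sum>q\<le>n. sigma n q \<mu> * (real (n - q) * r ^ (n - q - 1)))"
  have "((\<lambda>z. \<Sum>q\<le>n. sigma n q \<mu> * z ^ (n - q)) has_real_derivative D) (at r)"
    unfolding D_def by (auto intro!: derivative_eq_intros sum.cong)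
  then have d1: "((\<lambda>z. \<Prod>j\<in>{1..n}. \<mu> j + z) has_real_derivative D) (at r)"
    by (simp only: prod_shift_eq_sum_sigma)
  have fac: "(\<Prod>j\<in>{1..n}. \<mu> j + z) = h z * (z - r)" for z
    unfolding h_def r_def using n by (subst prod.remove[of _ 2]) (auto simp: mult.commute)
  have "isCont h r" unfolding h_def by (intro continuous_intros)
  then have d2: "((\<lambda>z. \<Prod>j\<in>{1..n}. \<mu> j + z) has_real_derivative h r) (at r)"
    unfolding CARAT_DERIV by (intro exI[of _ h]) (simp add: fac del: One_nat_def)
  have "sigma n q \<mu> \<ge> 0" if "q \<le> n - 1" for q
    using that G by (cases "q = 0") (auto simp: sigma_0 Gamma_cone_def intro: less_imp_le)
  then have nonneg: "sigma n q \<mu> * (real (n - q) * r ^ (n - q - 1)) \<ge> 0" if "q \<le> n" for q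
    using that r by (cases "q = n") auto
  have "sigma n (n - 1) \<mu> * (real (n - (n - 1)) * r ^ (n - (n - 1) - 1)) \<le> D"
    unfolding D_def by (rule member_le_sum) (use nonneg in auto)
  moreover have "sigma n (n - 1) \<mu> > 0" using G n by (auto simp: Gamma_cone_def)
  ultimately have "D > 0" using n by simp
  moreover have "h r \<le> 0"
  proof -
    have "h r = (\<mu> 1 + r) * (\<Prod>j\<in>{1..n} - {2} - {1}. \<mu> j + r)"
      unfolding h_def using n by (intro prod.remove) auto
    moreover have "\<mu> 1 + r \<le> 0"
      using mono_onD[OF mono, of 1 2] n by (simp add: r_def)
    moreover have "(\<Prod>j\<in>{1..n} - {2} - {1}. \<mu> j + r) \<ge> 0"
    proof (rule prod_nonneg)
      fix j assume "j \<in> {1..n} - {2} - {1}"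
      then show "0 \<le> \<mu> j + r" using mono_onD[OF mono, of 2 j] n by (auto simp: r_def)
    qed
    ultimately show ?thesis by (simp add: mult_nonpos_nonneg)
  qed
  ultimately show False using DERIV_unique[OF d1 d2] by simp
qed

section \<open>Quadratic forms weighted by a probability vector\<close>

text \<open>
  The form \<open>\<Sum> d\<^sub>j v\<^sub>j\<^sup>2 - c (\<Sum> p\<^sub>j v\<^sub>j)\<^sup>2\<close> with positive \<open>d\<^sub>j\<close> is nonnegative as soon as
  \<open>c (\<Sum> p\<^sub>j\<^sup>2/d\<^sub>j) \<le> 1\<close>. All lower bounds in this section with a negative square of the mean are
  obtained in this way.
\<close>

lemma weighted_Cauchy_Schwarz:
  fixes p v d :: "'a \<Rightarrow> real"
  assumes "\<And>j. j \<in> I \<Longrightarrow> d j > 0"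
  shows "(\<Sum>j\<in>I. p j * v j)\<^sup>2 \<le> (\<Sum>j\<in>I. (p j)\<^sup>2 / d j) * (\<Sum>j\<in>I. d j * (v j)\<^sup>2)"
proof -
  have "(\<Sum>j\<in>I. p j * v j) = (\<Sum>j\<in>I. (p j / sqrt (d j)) * (sqrt (d j) * v j))"
    using assms by (intro sum.cong refl) (simp add: less_imp_neq[THEN not_sym])
  then have "(\<Sum>j\<in>I. p j * v j)\<^sup>2
      \<le> (\<Sum>j\<in>I. (p j / sqrt (d j))\<^sup>2) * (\<Sum>j\<in>I. (sqrt (d j) * v j)\<^sup>2)"
    using Cauchy_Schwarz_ineq_sum[of "\<lambda>j. p j / sqrt (d j)" "\<lambda>j. sqrt (d j) * v j" I] by simp
  also have "(\<Sum>j\<in>I. (p j / sqrt (d j))\<^sup>2) = (\<Sum>j\<in>I. (p j)\<^sup>2 / d j)"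
    using assms by (intro sum.cong refl) (simp add: power_divide less_imp_le)
  also have "(\<Sum>j\<in>I. (sqrt (d j) * v j)\<^sup>2) = (\<Sum>j\<in>I. d j * (v j)\<^sup>2)"
    using assms by (intro sum.cong refl) (simp add: power_mult_distrib less_imp_le)
  finally show ?thesis .
qed

text \<open>
  This is the condition \<open>c (\<Sum> p\<^sub>j\<^sup>2/d\<^sub>j) \<le> 1\<close> for the form in \<open>variance_form_ge\<close>, where \<open>P\<close> is the
  largest and \<open>q\<close> the smallest weight. Write \<open>\<theta> = 1 - \<tau>\<close>, \<open>y = 2 (1 + \<eta>)\<close> and \<open>w = (2 - \<theta>) q\<close>. Up to
  the factor \<open>\<theta> q/2\<close>, the excess of \<open>\<Sum> p\<^sub>j\<^sup>2/d\<^sub>j\<close> over \<open>1/2\<close> is at most \<open>2/y - 1/(y - w)\<close> (by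
  \<open>P \<le> 1\<close>), whereas the excess of \<open>1/c\<close> over \<open>1/2\<close> is \<open>1/(y + w)\<close>. The convexity of the reciprocal,
  \<open>1/(y - w) + 1/(y + w) \<ge> 2/y\<close>, closes the gap.
\<close>

lemma dual_weight_bound:
  fixes P q \<tau> \<eta> :: real
  assumes "0 < q" "q \<le> P" "P + q \<le> 1" "0 < \<tau>" "\<tau> \<le> 1 / 2" "0 < \<eta>" "\<eta> \<le> \<tau> / 4"
  shows "(2 - (1 - \<tau>) * q / (1 + \<eta> + q)) * (1 / 2
      + (P / (2 + (1 - \<tau>) * q / ((1 + \<eta>) * P - q)) - P / 2)
      + (q / (2 - (1 - \<tau>) * (1 + \<tau> / 4)) - q / 2)) \<le> 1"
proof -
  define \<theta> where "\<theta> = 1 - \<tau>"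
  define R where "R = (1 + \<eta>) * P - q"
  define G where "G = 2 - \<theta> * (1 + \<tau> / 4)"
  define y where "y = 2 * (1 + \<eta>)"
  define w where "w = (2 - \<theta>) * q"
  have \<theta>: "0 < \<theta>" "\<theta> < 1" using assms by (auto simp: \<theta>_def)
  have "\<eta> * P > 0" using assms by simp
  moreover have "R = \<eta> * P + (P - q)" by (simp add: R_def algebra_simps)
  ultimately have R: "R > 0" using assms by linarith
  have w: "0 < w" "w < y" 
  proof -
    show "0 < w" using \<theta> assms by (simp add: w_def)
    have "w \<le> 2 * q" using \<theta> assms by (simp add: w_def algebra_simps)
    then show "w < y" using assms by (simp add: y_def)
  qed
  have "\<theta> * (1 + \<tau> / 4) \<le> 1" using assms by (simp add: \<theta>_def algebra_simps)
  then have G: "G \<ge> 1" by (simp add: G_def)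
  have C: "2 - \<theta> * q / (1 + \<eta> + q) = 2 * (y + w) / (y + 2 * q)"
    using assms by (simp add: y_def w_def field_simps)
  have Cpos: "2 * (y + w) / (y + 2 * q) > 0" using w assms by simp
  have "P / (2 + \<theta> * q / R) - P / 2 = - (\<theta> * q / 2) * (P / (2 * R + \<theta> * q))"
  proof -
    have N: "2 * R + \<theta> * q > 0" using R \<theta> assms by (simp add: add_pos_pos)
    have "2 + \<theta> * q / R = (2 * R + \<theta> * q) / R" using R by (simp add: field_simps)
    then have "P / (2 + \<theta> * q / R) - P / 2 = P * R / (2 * R + \<theta> * q) - P / 2" by simp
    also have "\<dots> = (P * R * 2 - P * (2 * R + \<theta> * q)) / ((2 * R + \<theta> * q) * 2)"
      using N by (simp add: diff_frac_eq)
    finally show ?thesis by (simp add: algebra_simps)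
  qed
  also have "\<dots> \<le> - (\<theta> * q / 2) * (1 / (y - w))"
  proof -
    \<comment> \<open>\<open>P / (y * P - w) = 1 / (y - w / P)\<close> is smallest for \<open>P = 1\<close>.\<close>
    have eq: "2 * R + \<theta> * q = y * P - w" by (simp add: R_def y_def w_def algebra_simps)
    have "w * P \<le> w * 1" using w assms by (intro mult_left_mono) auto
    then have "y * P - w \<le> (y - w) * P" by (simp add: algebra_simps)
    moreover have "y * P - w > 0" using R \<theta> assms by (simp add: add_pos_pos flip: eq)
    ultimately have "1 / (y - w) \<le> P / (y * P - w)"
      using w by (simp add: divide_simps mult.commute)
    then have "\<theta> * q / 2 * (1 / (y - w)) \<le> \<theta> * q / 2 * (P / (y * P - w))"
      using \<theta> assms by (intro mult_left_mono) auto
    then show ?thesis unfolding eq by linarith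
  qed
  finally have s1: "P / (2 + \<theta> * q / R) - P / 2 \<le> - (\<theta> * q / 2) * (1 / (y - w))" .
  have "q / G - q / 2 = \<theta> * q / 2 * ((1 + \<tau> / 4) / G)"
  proof -
    have "\<theta> * (1 + \<tau> / 4) = 2 - G" by (simp add: G_def)
    then have "\<theta> * q / 2 * ((1 + \<tau> / 4) / G) = q * (2 - G) / (2 * G)"
      by (metis (no_types, lifting) mult.commute mult.left_commute times_divide_times_eq)
    then show ?thesis using G by (simp add: field_simps)
  qed
  also have "\<dots> \<le> \<theta> * q / 2 * (2 / y)"
  proof (rule mult_left_mono)
    have "(1 + \<tau> / 4) * (1 + \<eta>) \<le> (1 + \<tau> / 4) * (1 + \<tau> / 4)"
      using assms by (intro mult_left_mono) auto
    also have "\<dots> \<le> G"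
    proof -
      have "G - (1 + \<tau> / 4) * (1 + \<tau> / 4) = \<tau> / 4 + 3 / 16 * (\<tau> * \<tau>)"
        by (simp add: G_def \<theta>_def field_simps)
      moreover have "\<tau> / 4 + 3 / 16 * (\<tau> * \<tau>) \<ge> 0" using assms by simp
      ultimately show ?thesis by linarith
    qed
    finally have "(1 + \<tau> / 4) / G \<le> 1 / (1 + \<eta>)"
      using G assms by (simp add: pos_divide_le_eq pos_le_divide_eq)
    moreover have "2 / y = 1 / (1 + \<eta>)" using assms by (simp add: y_def field_simps)
    ultimately show "(1 + \<tau> / 4) / G \<le> 2 / y" by simp
  qed (use \<theta> assms in auto)
  finally have s2: "q / G - q / 2 \<le> \<theta> * q / 2 * (2 / y)" .
  have "2 / y \<le> 1 / (y - w) + 1 / (y + w)"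
  proof -
    have "(y - w) * (y + w) > 0" using w by simp
    moreover have "(y - w) * (y + w) \<le> y * y" by (simp add: algebra_simps)
    ultimately have "2 * y / (y * y) \<le> 2 * y / ((y - w) * (y + w))"
      using w by (intro divide_left_mono) auto
    also have "\<dots> = 1 / (y - w) + 1 / (y + w)"
      using w by (simp add: field_simps)
    finally show ?thesis using w by simp
  qed
  then have "\<theta> * q / 2 * (2 / y) \<le> \<theta> * q / 2 * (1 / (y - w) + 1 / (y + w))"
    using \<theta> assms by (intro mult_left_mono) auto
  with s1 s2 have "1 / 2 + (P / (2 + \<theta> * q / R) - P / 2) + (q / G - q / 2)
      \<le> 1 / 2 + \<theta> * q / 2 * (1 / (y + w))"
    unfolding distrib_left by linarith
  also have "\<dots> = (y + 2 * q) / (2 * (y + w))"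
    using w by (simp add: field_simps) (simp add: w_def algebra_simps)
  finally have "2 * (y + w) / (y + 2 * q) * (1 / 2 + (P / (2 + \<theta> * q / R) - P / 2) + (q / G - q / 2))
      \<le> 2 * (y + w) / (y + 2 * q) * ((y + 2 * q) / (2 * (y + w)))"
    using Cpos by (intro mult_left_mono) auto
  also have "\<dots> = 1" using w assms by simp
  finally show ?thesis by (simp only: C[symmetric] \<theta>_def R_def G_def)
qed

lemma two_masses_le:
  fixes p :: "'a \<Rightarrow> real"
  assumes "finite I" "a \<in> I" "z \<in> I" "a \<noteq> z" "\<And>j. j \<in> I \<Longrightarrow> p j > 0"
  shows "p a + p z \<le> sum p I"
proof -
  have "sum p {a, z} \<le> sum p I"
    using assms by (intro sum_mono2) (auto intro: less_imp_le)
  then show ?thesis using assms by simp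
qed

text \<open>
  The case \<open>b = 0\<close>. The coefficients \<open>d\<^sub>j\<close> of the squares \<open>v\<^sub>j\<^sup>2\<close> are \<open>2 p\<^sub>j\<close>, increased at \<open>a\<close> and
  lowered at \<open>z\<close>, where the lowering also contains the claimed margin. The coefficient of \<open>-E\<^sup>2\<close> is
  \<open>C = 2 - (1 - \<tau>) p\<^sub>z/(1 + \<eta> + p\<^sub>z)\<close>. Without the gain from the positive multiple of \<open>E\<^sup>2\<close> and the gain at
  \<open>a\<close>, constant \<open>v\<close> would violate the inequality, since its variance is \<open>0\<close>.
\<close>

lemma variance_form_ge:
  fixes p v :: "'a \<Rightarrow> real" and \<tau> \<eta> :: real
  assumes I: "finite I" "a \<in> I" "z \<in> I" "a \<noteq> z" and p: "\<And>j. j \<in> I \<Longrightarrow> p j > 0"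
    and one: "sum p I = 1" and za: "p z \<le> p a"
    and \<tau>: "0 < \<tau>" "\<tau> \<le> 1 / 2" and \<eta>: "0 < \<eta>" "\<eta> \<le> \<tau> / 4"
  defines "E \<equiv> (\<Sum>j\<in>I. p j * v j)"
  shows "(1 - \<tau>) * (\<tau> / 4) * p z * (v z)\<^sup>2
    \<le> 2 * ((\<Sum>j\<in>I. p j * (v j)\<^sup>2) - E\<^sup>2)
      + (1 - \<tau>) * (E\<^sup>2 * p z / (1 + \<eta> + p z)
          + p a * (v a)\<^sup>2 * p z / ((1 + \<eta>) * p a - p z) - p z * (v z)\<^sup>2)"
proof -
  define \<theta> where "\<theta> = 1 - \<tau>"
  define R where "R = (1 + \<eta>) * p a - p z"
  define G where "G = 2 - \<theta> * (1 + \<tau> / 4)"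
  define C where "C = 2 - \<theta> * p z / (1 + \<eta> + p z)"
  define d where "d = (\<lambda>j. if j = a then p a * (2 + \<theta> * p z / R)
    else if j = z then p z * G else 2 * p j)"
  have \<theta>: "0 < \<theta>" "\<theta> < 1" using \<tau> by (auto simp: \<theta>_def)
  have pa: "p a > 0" and pz: "p z > 0" using p I by auto
  have le1: "p a + p z \<le> 1" using two_masses_le[of I a z p] I p one by simp
  have "\<eta> * p a > 0" using \<eta> pa by simp
  moreover have "R = \<eta> * p a + (p a - p z)" by (simp add: R_def algebra_simps)
  ultimately have R: "R > 0" using za by linarith
  have "\<theta> * (1 + \<tau> / 4) \<le> 1" using \<tau> by (simp add: \<theta>_def algebra_simps)
  then have G: "G \<ge> 1" by (simp add: G_def)
  have dpos: "d j > 0" if "j \<in> I" for j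
    using that p pa pz R \<theta> G by (auto simp: d_def intro!: mult_pos_pos add_pos_pos divide_pos_pos)
  have sd: "(\<Sum>j\<in>I. d j * (v j)\<^sup>2) = 2 * (\<Sum>j\<in>I. p j * (v j)\<^sup>2)
      + \<theta> * p a * p z / R * (v a)\<^sup>2 - \<theta> * (1 + \<tau> / 4) * p z * (v z)\<^sup>2"
  proof -
    have "(\<Sum>j\<in>I. d j * (v j)\<^sup>2) = (\<Sum>j\<in>I. 2 * (p j * (v j)\<^sup>2)
        + (if j = a then \<theta> * p a * p z / R * (v a)\<^sup>2 else 0)
        + (if j = z then - \<theta> * (1 + \<tau> / 4) * p z * (v z)\<^sup>2 else 0))"
      using I(4) by (intro sum.cong refl) (auto simp: d_def G_def algebra_simps)
    then show ?thesis using I by (simp add: sum.distrib sum_distrib_left)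
  qed
  have sp: "(\<Sum>j\<in>I. (p j)\<^sup>2 / d j) = 1 / 2 + (p a / (2 + \<theta> * p z / R) - p a / 2)
      + (p z / G - p z / 2)"
  proof -
    have "(\<Sum>j\<in>I. (p j)\<^sup>2 / d j) = (\<Sum>j\<in>I. p j / 2
        + (if j = a then p a / (2 + \<theta> * p z / R) - p a / 2 else 0)
        + (if j = z then p z / G - p z / 2 else 0))"
      using I(4) p by (intro sum.cong refl) (auto simp: d_def power2_eq_square)
    then show ?thesis using I one by (simp add: sum.distrib flip: sum_divide_distrib)
  qed
  have C: "C > 0"
  proof -
    have "\<theta> * p z \<le> 1 * p z" using \<theta> pz by (intro mult_right_mono) auto
    also have "1 * p z < 2 * (1 + \<eta> + p z)" using pz \<eta> by simp
    finally have "\<theta> * p z / (1 + \<eta> + p z) < 2"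
      using pz \<eta> by (simp add: pos_divide_less_eq)
    then show ?thesis by (simp add: C_def)
  qed
  have CS: "C * (\<Sum>j\<in>I. (p j)\<^sup>2 / d j) \<le> 1"
    unfolding sp C_def R_def G_def \<theta>_def
    by (rule dual_weight_bound) (use pz za le1 \<tau> \<eta> in auto)
  have "C * E\<^sup>2 \<le> C * ((\<Sum>j\<in>I. (p j)\<^sup>2 / d j) * (\<Sum>j\<in>I. d j * (v j)\<^sup>2))"
    unfolding E_def using C dpos by (intro mult_left_mono weighted_Cauchy_Schwarz) auto
  also have "\<dots> \<le> 1 * (\<Sum>j\<in>I. d j * (v j)\<^sup>2)"
    unfolding mult.assoc[symmetric] using CS dpos
    by (intro mult_right_mono sum_nonneg) (auto intro!: mult_nonneg_nonneg dest: less_imp_le)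
  finally show ?thesis
    unfolding sd by (simp add: C_def R_def \<theta>_def algebra_simps)
qed

text \<open>
  The case \<open>b = 1\<close>. The weighted Cauchy-Schwarz inequality with weight \<open>\<tau>\<close> at \<open>z\<close> and \<open>1\<close> elsewhere
  requires \<open>\<Sum> p\<^sub>j\<^sup>2 + (1/\<tau> - 1) p\<^sub>z\<^sup>2 \<le> 1\<close>. Since \<open>p\<^sub>j \<le> 1\<close>, and even \<open>p\<^sub>a \<le> 1 - p\<^sub>z\<close>, the sum
  of the squares stays below \<open>1\<close> by \<open>p\<^sub>a p\<^sub>z\<close>, which pays for \<open>p\<^sub>z\<^sup>2/\<tau>\<close>.
\<close>

lemma square_mean_le_defective:
  fixes p v :: "'a \<Rightarrow> real"
  assumes I: "finite I" "a \<in> I" "z \<in> I" "a \<noteq> z" and p: "\<And>j. j \<in> I \<Longrightarrow> p j > 0"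
    and one: "sum p I = 1" and \<tau>: "0 < \<tau>" and za: "p z \<le> \<tau> * p a"
  shows "(\<Sum>j\<in>I. p j * v j)\<^sup>2 \<le> (\<Sum>j\<in>I. (v j)\<^sup>2) - (1 - \<tau>) * (v z)\<^sup>2"
proof -
  define d where "d = (\<lambda>j. if j = z then \<tau> else 1)"
  have pa: "p a > 0" and pz: "p z > 0" using p I by auto
  have le1: "p a + p z \<le> 1" using two_masses_le[of I a z p] I p one by simp
  have dpos: "d j > 0" for j using \<tau> by (simp add: d_def)
  have dv: "d j * (v j)\<^sup>2 \<ge> 0" for j using less_imp_le[OF dpos[of j]] by simp
  \<comment> \<open>The saving \<open>p a * p z\<close> at \<open>a\<close> and the extra cost at \<open>z\<close> cancel in the sum.\<close>
  have "(\<Sum>j\<in>I. (p j)\<^sup>2 / d j) \<le> (\<Sum>j\<in>I. p j + (if j = a then - p a * p z else 0)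
      + (if j = z then p z * p a else 0))"
  proof (rule sum_mono)
    fix j assume j: "j \<in> I"
    have "p j \<le> 1" using member_le_sum[of j I p] j I(1) p one by (auto intro: less_imp_le)
    then have 1: "p j * p j \<le> p j" using p[OF j] by simp
    have 2: "p a * p a \<le> p a * (1 - p z)" using pa le1 by (intro mult_left_mono) auto
    have "p z / \<tau> \<le> p a" using za \<tau> by (simp add: divide_le_eq mult.commute)
    then have "p z * (p z / \<tau>) \<le> p z * p a" using pz by (intro mult_left_mono) auto
    then have 3: "p z * p z / \<tau> \<le> p z + p z * p a" using pz by simp
    show "(p j)\<^sup>2 / d j \<le> p j + (if j = a then - p a * p z else 0)
      + (if j = z then p z * p a else 0)"
      using I(4) 1 2 3 by (auto simp: d_def power2_eq_square algebra_simps)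
  qed
  also have "\<dots> = 1" using I one by (simp add: sum.distrib)
  finally have S: "(\<Sum>j\<in>I. (p j)\<^sup>2 / d j) \<le> 1" .
  have "(\<Sum>j\<in>I. p j * v j)\<^sup>2 \<le> (\<Sum>j\<in>I. (p j)\<^sup>2 / d j) * (\<Sum>j\<in>I. d j * (v j)\<^sup>2)"
    using dpos by (rule weighted_Cauchy_Schwarz)
  also have "\<dots> \<le> 1 * (\<Sum>j\<in>I. d j * (v j)\<^sup>2)"
    using S dv by (intro mult_right_mono sum_nonneg)
  also have "(\<Sum>j\<in>I. d j * (v j)\<^sup>2)
      = (\<Sum>j\<in>I. (v j)\<^sup>2 + (if j = z then - (1 - \<tau>) * (v z)\<^sup>2 else 0))"
    by (intro sum.cong refl) (auto simp: d_def algebra_simps)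
  also have "\<dots> = (\<Sum>j\<in>I. (v j)\<^sup>2) - (1 - \<tau>) * (v z)\<^sup>2"
    using I by (simp add: sum.distrib algebra_simps)
  finally show ?thesis by simp
qed

lemma square_mean_le:
  fixes p v :: "'a \<Rightarrow> real"
  assumes I: "finite I" and p: "\<And>j. j \<in> I \<Longrightarrow> p j > 0" and one: "sum p I = 1"
  shows "(\<Sum>j\<in>I. p j * v j)\<^sup>2 \<le> (\<Sum>j\<in>I. (v j)\<^sup>2)"
proof -
  have "(\<Sum>j\<in>I. (p j)\<^sup>2) \<le> (\<Sum>j\<in>I. p j)"
  proof (rule sum_mono)
    fix j assume j: "j \<in> I"
    have "p j \<le> 1" using member_le_sum[of j I p] j I p one by (auto intro: less_imp_le)
    then show "(p j)\<^sup>2 \<le> p j" using p[OF j] by (simp add: power2_eq_square)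
  qed
  then have "(\<Sum>j\<in>I. (p j)\<^sup>2) * (\<Sum>j\<in>I. (v j)\<^sup>2) \<le> 1 * (\<Sum>j\<in>I. (v j)\<^sup>2)"
    using one by (intro mult_right_mono sum_nonneg) auto
  with Cauchy_Schwarz_ineq_sum[of p v I] show ?thesis by simp
qed

lemma affine_sum_split:
  fixes p v :: "'a \<Rightarrow> real"
  shows "(\<Sum>j\<in>I. (b - 2 * (b - 1) * p j) * (v j)\<^sup>2)
    = b * (\<Sum>j\<in>I. (v j)\<^sup>2) + 2 * (1 - b) * (\<Sum>j\<in>I. p j * (v j)\<^sup>2)"
  by (simp add: sum_distrib_left flip: sum.distrib) (simp add: algebra_simps)

text \<open>
  The form is affine in \<open>b\<close>, hence it is enough to check the ends of the interval. The case
  \<open>b = 1\<close> is \<open>square_mean_le_defective\<close>. At \<open>b = 1 + 1/p\<^sub>a\<close> all coefficients are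
  nonnegative: \<open>p\<^sub>j \<le> p\<^sub>a\<close> takes care of \<open>j \<noteq> z\<close>, and \<open>p\<^sub>z \<le> \<tau> p\<^sub>a\<close> of \<open>j = z\<close>.
\<close>

lemma form_nonneg_b_ge_1:
  fixes p v :: "'a \<Rightarrow> real" and \<tau> b :: real
  assumes I: "finite I" "a \<in> I" "z \<in> I" "a \<noteq> z" and p: "\<And>j. j \<in> I \<Longrightarrow> p j > 0"
    and pmax: "\<And>j. j \<in> I \<Longrightarrow> p j \<le> p a"
    and one: "sum p I = 1" and \<tau>: "0 < \<tau>" "\<tau> \<le> 1" and za: "p z \<le> \<tau> * p a"
    and b: "1 \<le> b" "b \<le> 1 + 1 / p a"
  defines "E \<equiv> (\<Sum>j\<in>I. p j * v j)"
  shows "0 \<le> (b - 2) * E\<^sup>2 + (\<Sum>j\<in>I. (b - 2 * (b - 1) * p j) * (v j)\<^sup>2)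
    - (1 - \<tau>) * (b - (b - 1) * p z) * (v z)\<^sup>2"
proof -
  define form where "form = (\<lambda>b. (b - 2) * E\<^sup>2 + (\<Sum>j\<in>I. (b - 2 * (b - 1) * p j) * (v j)\<^sup>2)
    - (1 - \<tau>) * (b - (b - 1) * p z) * (v z)\<^sup>2)"
  define c where "c = 1 / p a"
  \<comment> \<open>\<open>b\<close> divides the interval from \<open>1\<close> to \<open>1 + c\<close> in the ratio \<open>l : 1 - l\<close>.\<close>
  define l where "l = (b - 1) * p a"
  have pa: "p a > 0" and pz: "p z > 0" using p I by auto
  have le1: "p a + p z \<le> 1" using two_masses_le[of I a z p] I p one by simp
  have c: "c \<ge> 1" using pa pz le1 by (simp add: c_def)
  have l: "0 \<le> l" "l \<le> 1" using b pa by (auto simp: l_def field_simps)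
  have lc: "l * c = b - 1" using pa by (simp add: l_def c_def)
  have f1: "form 1 \<ge> 0"
    using square_mean_le_defective[where p = p and v = v, OF I p one \<tau>(1) za] by (simp add: form_def E_def)
  have f2: "form (1 + c) \<ge> 0"
  proof -
    have cp: "c * p j \<le> 1" if "j \<in> I" for j using pmax[OF that] pa by (simp add: c_def)
    have "(1 + c - 2 * c * p z) * (v z)\<^sup>2 \<le> (\<Sum>j\<in>I. (1 + c - 2 * c * p j) * (v j)\<^sup>2)"
    proof (rule member_le_sum)
      fix j assume "j \<in> I - {z}"
      then show "0 \<le> (1 + c - 2 * c * p j) * (v j)\<^sup>2"
        using cp[of j] c by (intro mult_nonneg_nonneg) auto
    qed (use I in auto)
    moreover have "(1 - \<tau>) * (1 + c - c * p z) * (v z)\<^sup>2 \<le> (1 + c - 2 * c * p z) * (v z)\<^sup>2"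
    proof (rule mult_right_mono)
      have x: "c * p z \<le> \<tau>" using za pa by (simp add: c_def divide_le_eq)
      have "c * p z * (1 + \<tau>) \<le> \<tau> * (1 + \<tau>)" using x \<tau> by (intro mult_right_mono) auto
      also have "\<dots> \<le> \<tau> * (1 + c)" using c \<tau> by (intro mult_left_mono) auto
      finally show "(1 - \<tau>) * (1 + c - c * p z) \<le> 1 + c - 2 * c * p z"
        by (simp add: algebra_simps)
    qed simp
    moreover have "(c - 1) * E\<^sup>2 \<ge> 0" using c by simp
    ultimately show ?thesis by (simp add: form_def)
  qed
  have aff: "form x = form 1 + (x - 1) * (form 2 - form 1)" for x
    unfolding form_def affine_sum_split by (simp add: algebra_simps)
  have "form b = (1 - l) * form 1 + l * form (1 + c)"
    unfolding aff[of b] aff[of "1 + c"] lc[symmetric] by (simp add: algebra_simps)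
  then have "form b \<ge> 0" using f1 f2 l by simp
  then show ?thesis by (simp add: form_def)
qed

lemma Titu_two:
  fixes x y b d :: real
  assumes "b > 0" "d > 0"
  shows "(x + y)\<^sup>2 / (b + d) \<le> x\<^sup>2 / b + y\<^sup>2 / d"
proof -
  have "x\<^sup>2 / b + y\<^sup>2 / d - (x + y)\<^sup>2 / (b + d) = (x * d - y * b)\<^sup>2 / (b * d * (b + d))"
    using assms by (simp add: divide_simps add_pos_pos less_imp_neq[THEN not_sym])
      (simp add: power2_eq_square algebra_simps)
  moreover have "\<dots> \<ge> 0" using assms by simp
  ultimately show ?thesis by linarith
qed

text \<open>
  The form is \<open>(1 - b) F\<^sub>0 + b F\<^sub>1\<close> with its values \<open>F\<^sub>0\<close> and \<open>F\<^sub>1\<close> at \<open>b = 0\<close> and \<open>b = 1\<close>. Always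
  \<open>F\<^sub>0 \<ge> 0\<close>. If \<open>p\<^sub>z \<le> \<tau> p\<^sub>a\<close>, then also \<open>F\<^sub>1 \<ge> 0\<close>. Otherwise \<open>F\<^sub>1\<close> may be negative, but not below
  \<open>-(1 - \<tau>) v\<^sub>z\<^sup>2\<close>, and for small \<open>b\<close> the margin in \<open>variance_form_ge\<close> compensates for this.
\<close>

lemma form_nonneg_b_le_1:
  fixes p v :: "'a \<Rightarrow> real" and \<tau> \<eta> b :: real
  assumes I: "finite I" "a \<in> I" "z \<in> I" "a \<noteq> z" and p: "\<And>j. j \<in> I \<Longrightarrow> p j > 0"
    and one: "sum p I = 1" and za: "p z \<le> p a"
    and \<tau>: "0 < \<tau>" "\<tau> \<le> 1 / 2" and \<eta>: "0 < \<eta>" "\<eta> \<le> \<tau> / 4"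
    and b: "0 < b" "b \<le> 1" and dich: "p z \<le> \<tau> * p a \<or> b \<le> \<tau> / 8 * p z"
  defines "E \<equiv> (\<Sum>j\<in>I. p j * v j)"
  shows "0 \<le> (b - 2) * E\<^sup>2 + (\<Sum>j\<in>I. (b - 2 * (b - 1) * p j) * (v j)\<^sup>2)
    + (1 - \<tau>) * (E\<^sup>2 * p z / (1 + \<eta> + p z)
        + (b - (b - 1) * p a) * (v a)\<^sup>2 * p z / ((1 + \<eta>) * p a - p z)
        - (b - (b - 1) * p z) * (v z)\<^sup>2)"
proof -
  define \<theta> where "\<theta> = 1 - \<tau>"
  define U where "U = E\<^sup>2 * p z / (1 + \<eta> + p z)"
  define W where "W = (v a)\<^sup>2 * p z / ((1 + \<eta>) * p a - p z)"
  define F0 where "F0 = 2 * ((\<Sum>j\<in>I. p j * (v j)\<^sup>2) - E\<^sup>2) + \<theta> * (U + p a * W - p z * (v z)\<^sup>2)"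
  define F1 where "F1 = (\<Sum>j\<in>I. (v j)\<^sup>2) - E\<^sup>2 + \<theta> * (U + W - (v z)\<^sup>2)"
  have \<theta>: "0 < \<theta>" "\<theta> < 1" using \<tau> by (auto simp: \<theta>_def)
  have pa: "p a > 0" and pz: "p z > 0" using p I by auto
  have le1: "p a + p z \<le> 1" using two_masses_le[of I a z p] I p one by simp
  have "\<eta> * p a > 0" using \<eta> pa by simp
  moreover have "(1 + \<eta>) * p a - p z = \<eta> * p a + (p a - p z)" by (simp add: algebra_simps)
  ultimately have "(1 + \<eta>) * p a - p z > 0" using za by linarith
  then have W: "W \<ge> 0" using pz by (simp add: W_def)
  have U: "U \<ge> 0" using pz \<eta> by (simp add: U_def)
  have F0: "F0 \<ge> \<theta> * (\<tau> / 4 * p z * (v z)\<^sup>2)"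
    using variance_form_ge[where p = p and v = v, OF I p one za \<tau> \<eta>]
    by (simp add: F0_def \<theta>_def U_def W_def E_def mult.assoc)
  have "\<theta> * (U + W) \<ge> 0" using \<theta> U W by simp
  then have F1: "F1 \<ge> (\<Sum>j\<in>I. (v j)\<^sup>2) - E\<^sup>2 - \<theta> * (v z)\<^sup>2"
    by (simp add: F1_def algebra_simps)
  have "(1 - b) * F0 + b * F1 \<ge> 0"
    using dich
  proof
    assume "p z \<le> \<tau> * p a"
    from square_mean_le_defective[where p = p and v = v, OF I p one \<tau>(1) this] F1
    have "F1 \<ge> 0" by (simp add: E_def \<theta>_def)
    moreover have "F0 \<ge> 0" using F0 \<theta> \<tau> pz by (smt (verit) mult_nonneg_nonneg zero_le_power2 divide_nonneg_nonneg)
    ultimately show ?thesis using b by simp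
  next
    assume bs: "b \<le> \<tau> / 8 * p z"
    have "\<tau> / 8 * p z \<le> 1 / 2 * 1" using \<tau> pz pa le1 by (intro mult_mono) auto
    then have b2: "1 - b \<ge> 1 / 2" using bs by simp
    have "F1 \<ge> - (\<theta> * (v z)\<^sup>2)"
      using F1 square_mean_le[where p = p and v = v, OF I(1) p one] by (simp add: E_def)
    then have "b * F1 \<ge> b * - (\<theta> * (v z)\<^sup>2)" using b by (intro mult_left_mono) auto
    moreover have "(1 - b) * F0 \<ge> 1 / 2 * (\<theta> * (\<tau> / 4 * p z * (v z)\<^sup>2))"
      using b2 F0 \<theta> \<tau> pz by (intro mult_mono) auto
    moreover have "b * (\<theta> * (v z)\<^sup>2) \<le> \<tau> / 8 * p z * (\<theta> * (v z)\<^sup>2)"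
      using bs \<theta> by (intro mult_right_mono) auto
    ultimately show ?thesis by (simp add: algebra_simps)
  qed
  moreover have "(b - 2) * E\<^sup>2 + (\<Sum>j\<in>I. (b - 2 * (b - 1) * p j) * (v j)\<^sup>2)
    + \<theta> * (U + (b - (b - 1) * p a) * W - (b - (b - 1) * p z) * (v z)\<^sup>2) = (1 - b) * F0 + b * F1"
    unfolding affine_sum_split F0_def F1_def by (simp add: algebra_simps)
  ultimately show ?thesis by (simp add: \<theta>_def U_def W_def mult.assoc)
qed

text \<open>
  For \<open>b \<le> 1\<close> the two squares that contain \<open>X\<close> are bounded below by a multiple of \<open>E\<^sup>2\<close> with
  \<open>Titu_two\<close>, and the parts of the two denominators that depend on \<open>b\<close> cancel in their sum. This is why
  the remaining form is affine in \<open>b\<close>. For \<open>b > 1\<close> the squares with \<open>X\<close> and the diagonal gains are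
  nonnegative and can be dropped.
\<close>

lemma normalized_form_nonneg:
  fixes p v :: "'a \<Rightarrow> real" and \<tau> \<eta> b X :: real
  assumes I: "finite I" "a \<in> I" "z \<in> I" "a \<noteq> z" and p: "\<And>j. j \<in> I \<Longrightarrow> p j > 0"
    and pmax: "\<And>j. j \<in> I \<Longrightarrow> p j \<le> p a" and pmin: "\<And>j. j \<in> I \<Longrightarrow> p z \<le> p j"
    and one: "sum p I = 1"
    and \<tau>: "0 < \<tau>" "\<tau> \<le> 1 / 2" and \<eta>: "0 < \<eta>" "\<eta> \<le> \<tau> / 4"
    and b: "0 < b" "b \<le> 1 + 1 / p a" and dich: "p z \<le> \<tau> * p a \<or> b \<le> \<tau> / 8 * p z"
  defines "E \<equiv> (\<Sum>j\<in>I. p j * v j)"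
  shows "0 \<le> (X + E)\<^sup>2 / b + (b - 2) * E\<^sup>2 + (\<Sum>j\<in>I. (b - 2 * (b - 1) * p j) * (v j)\<^sup>2)
    + (1 - \<tau>) * (X\<^sup>2 * p z / (1 + \<eta> - (b - 1) * p z)
        + (\<Sum>j\<in>I - {z}. (b - (b - 1) * p j) * (v j)\<^sup>2 * p z / ((1 + \<eta>) * p j - p z))
        - (b - (b - 1) * p z) * (v z)\<^sup>2)"
proof -
  define \<theta> where "\<theta> = 1 - \<tau>"
  define T where "T = (\<lambda>j. (b - (b - 1) * p j) * (v j)\<^sup>2 * p z / ((1 + \<eta>) * p j - p z))"
  define Y where "Y = X\<^sup>2 * p z / (1 + \<eta> - (b - 1) * p z)"
  have \<theta>: "0 < \<theta>" "\<theta> < 1" using \<tau> by (auto simp: \<theta>_def)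
  have pa: "p a > 0" and pz: "p z > 0" using p I by auto
  have le1: "p a + p z \<le> 1" using two_masses_le[of I a z p] I p one by simp
  have bp: "(b - 1) * p j \<le> 1" if "j \<in> I" for j
  proof -
    have "(b - 1) * p j \<le> 1 / p a * p j" using b p[OF that] by (intro mult_right_mono) auto
    also have "\<dots> \<le> 1" using pmax[OF that] pa by simp
    finally show ?thesis .
  qed
  have bq: "b - (b - 1) * p j \<ge> 0" if "j \<in> I" for j
  proof (cases "b \<le> 1")
    case True
    then have "(b - 1) * p j \<le> 0" using p[OF that] by (simp add: mult_nonpos_nonneg)
    then show ?thesis using b by simp
  qed (use bp[OF that] in simp)
  have T: "T j \<ge> 0" if "j \<in> I" for j
  proof -
    have "\<eta> * p j > 0" using \<eta> p[OF that] by simp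
    moreover have "(1 + \<eta>) * p j - p z = \<eta> * p j + (p j - p z)" by (simp add: algebra_simps)
    ultimately have "(1 + \<eta>) * p j - p z \<ge> 0" using pmin[OF that] by linarith
    then show ?thesis using bq[OF that] pz by (simp add: T_def)
  qed
  have Ta: "T a \<le> sum T (I - {z})" using T I by (intro member_le_sum) auto
  have den: "1 + \<eta> - (b - 1) * p z > 0" using bp[OF I(3)] \<eta> by simp
  have Y: "Y \<ge> 0" using den pz by (simp add: Y_def)
  have Zb: "(X + E)\<^sup>2 / b \<ge> 0" using b by simp
  have "0 \<le> (X + E)\<^sup>2 / b + (b - 2) * E\<^sup>2 + (\<Sum>j\<in>I. (b - 2 * (b - 1) * p j) * (v j)\<^sup>2)
    + \<theta> * (Y + sum T (I - {z}) - (b - (b - 1) * p z) * (v z)\<^sup>2)"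
  proof (cases "b \<le> 1")
    case True
    \<comment> \<open>Chosen such that \<open>X\<^sup>2 / d\<close> is the gain in \<open>X\<close>; then \<open>b + d\<close> does not depend on \<open>b\<close>.\<close>
    define d where "d = (1 + \<eta>) / p z + (1 - b)"
    have d: "d > 0" using True pz \<eta> by (simp add: d_def add_pos_nonneg)
    have "E\<^sup>2 * p z / (1 + \<eta> + p z) = (X + E + - X)\<^sup>2 / (b + d)"
      using pz \<eta> by (simp add: d_def field_simps)
    also have "\<dots> \<le> (X + E)\<^sup>2 / b + (- X)\<^sup>2 / d" by (rule Titu_two[OF b(1) d])
    also have "(- X)\<^sup>2 / d = Y"
    proof -
      have "d = (1 + \<eta> - (b - 1) * p z) / p z" using pz by (simp add: d_def field_simps)
      then show ?thesis by (simp add: Y_def)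
    qed
    finally have "\<theta> * (E\<^sup>2 * p z / (1 + \<eta> + p z)) \<le> \<theta> * ((X + E)\<^sup>2 / b + Y)"
      using \<theta> by (intro mult_left_mono) auto
    moreover have "\<theta> * ((X + E)\<^sup>2 / b) \<le> 1 * ((X + E)\<^sup>2 / b)"
      using \<theta> Zb by (intro mult_right_mono) auto
    moreover have "\<theta> * T a \<le> \<theta> * sum T (I - {z})" using Ta \<theta> by (intro mult_left_mono) auto
    moreover have "0 \<le> (b - 2) * E\<^sup>2 + (\<Sum>j\<in>I. (b - 2 * (b - 1) * p j) * (v j)\<^sup>2)
      + \<theta> * (E\<^sup>2 * p z / (1 + \<eta> + p z) + T a - (b - (b - 1) * p z) * (v z)\<^sup>2)"
      using form_nonneg_b_le_1[where p = p, OF I p one pmin[OF I(2)] \<tau> \<eta> b(1) True dich, of v]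
      by (simp add: \<theta>_def T_def E_def)
    ultimately show ?thesis by (simp add: distrib_left right_diff_distrib)
  next
    case False
    have "\<tau> / 8 * p z \<le> 1 * 1" using \<tau> pz pa le1 by (intro mult_mono) auto
    then have za: "p z \<le> \<tau> * p a" using dich False by simp
    have "0 \<le> (b - 2) * E\<^sup>2 + (\<Sum>j\<in>I. (b - 2 * (b - 1) * p j) * (v j)\<^sup>2)
      - \<theta> * (b - (b - 1) * p z) * (v z)\<^sup>2"
      unfolding E_def \<theta>_def
      by (rule form_nonneg_b_ge_1[where p = p, OF I p pmax one _ _ za _ b(2)]) (use \<tau> False in auto)
    moreover have "\<theta> * (Y + sum T (I - {z})) \<ge> 0"
      using \<theta> Y T by (intro mult_nonneg_nonneg add_nonneg_nonneg sum_nonneg) auto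
    ultimately show ?thesis
      using Zb unfolding right_diff_distrib[of \<theta> "_ + _"] mult.assoc[of \<theta>] by linarith
  qed
  then show ?thesis by (simp add: \<theta>_def T_def Y_def)
qed

section \<open>The inequality for real vectors\<close>

text \<open>
  The translation into the variables \<open>X\<close>, \<open>v\<close>, \<open>p\<close>, \<open>b\<close> described at the beginning, with \<open>\<eta> = \<epsilon>/\<mu>\<^sub>n\<close>.
  The alternative in the last assumption is \<open>p\<^sub>n \<le> \<tau> p\<^sub>2 \<or> b \<le> \<tau>/8 p\<^sub>n\<close>.
\<close>

lemma real_form_inequality:
  fixes \<mu> u :: "nat \<Rightarrow> real" and \<tau> \<epsilon> :: real
  assumes n: "n \<ge> 3" and pos: "\<And>j. j \<in> {2..n} \<Longrightarrow> \<mu> j > 0" and mono: "mono_on {1..n} \<mu>"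
    and \<tau>: "0 < \<tau>" "\<tau> \<le> 1 / 2" and \<epsilon>: "0 < \<epsilon>" "\<epsilon> / \<mu> n \<le> \<tau> / 4"
    and s: "sigma n (n - 1) \<mu> > 0"
  defines "Q \<equiv> \<Prod>j\<in>{2..n}. \<mu> j" and "t \<equiv> \<Sum>j\<in>{2..n}. 1 / \<mu> j"
  assumes dich: "\<mu> 2 \<le> \<tau> * \<mu> n \<or> sigma n (n - 1) \<mu> / Q \<le> \<tau> / 8 * (1 / (t * \<mu> n))"
  shows "0 \<le> - (\<Sum>j=1..n. \<Sum>k\<in>{1..n} - {j}. sigma_del2 n (n - 3) \<mu> j k * u j * u k)
      - (1 - \<tau>) / \<mu> n * sigma_del n (n - 2) \<mu> n * (u n)\<^sup>2
      + ((real n)\<^sup>2 / sigma n (n - 1) \<mu>) * (\<Sum>j=1..n. sigma_del n (n - 2) \<mu> j * u j)\<^sup>2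
      + (1 - \<tau>) * (\<Sum>j=1..n - 1. sigma_del n (n - 2) \<mu> j * (u j)\<^sup>2 / (\<mu> n + \<epsilon> - \<mu> j))"
proof -
  define B where "B = {2..n}"
  define b where "b = 1 + \<mu> 1 * t"
  define p where "p = (\<lambda>j. 1 / (t * \<mu> j))"
  define v where "v = (\<lambda>j. u j / \<mu> j)"
  define X where "X = t * u 1"
  define \<eta> where "\<eta> = \<epsilon> / \<mu> n"
  define E where "E = (\<Sum>j\<in>B. p j * v j)"
  define V where "V = (\<Sum>j\<in>B. v j)"
  have nz: "\<mu> j \<noteq> 0" if "j \<in> {2..n}" for j using pos[OF that] by simp
  have posB: "\<mu> j > 0" if "j \<in> B" for j using pos that by (simp add: B_def)
  have nB: "n \<in> B" "2 \<in> B" "2 \<noteq> n" "finite B" "1 \<notin> B" using n by (auto simp: B_def)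
  have Q: "Q > 0" unfolding Q_def by (rule prod_pos) (use pos in auto)
  have t: "t > 0" unfolding t_def by (rule sum_pos) (use pos n in auto)
  have sb: "sigma n (n - 1) \<mu> = Q * b"
    using sigma_pred_eq[of n \<mu>] nz n by (simp add: Q_def b_def t_def)
  have b: "b > 0" using s[unfolded sb] Q by (simp add: zero_less_mult_iff)
  have \<mu>n: "\<mu> n > 0" using posB nB by auto
  have le_n: "\<mu> j \<le> \<mu> n" if "j \<in> {1..n}" for j using mono_onD[OF mono, of j n] that by auto
  have p: "p j > 0" if "j \<in> B" for j using posB[OF that] t by (simp add: p_def)
  have bm: "\<mu> 1 / \<mu> j = (b - 1) * p j" for j using t by (simp add: b_def p_def)
  have inv: "1 / \<mu> j = t * p j" for j using t by (simp add: p_def)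
  have uv: "u j = \<mu> j * v j" if "j \<in> B" for j using posB[OF that] by (simp add: v_def)
  have del1: "sigma_del n (n - 2) \<mu> 1 = Q * t"
    using sigma_del_first_eq[of n \<mu>] nz n by (simp add: Q_def t_def)
  have delj: "sigma_del n (n - 2) \<mu> j = Q * (b - (b - 1) * p j) / \<mu> j" if "j \<in> B" for j
  proof -
    have "sigma_del n (n - 2) \<mu> j = Q / \<mu> j * (1 + \<mu> 1 * (t - 1 / \<mu> j))"
      using sigma_del_eq[of j n \<mu>] nz that by (simp add: Q_def t_def B_def)
    also have "1 + \<mu> 1 * (t - 1 / \<mu> j) = b - (b - 1) * p j"
      unfolding bm[symmetric] by (simp add: b_def algebra_simps)
    finally show ?thesis by simp
  qed
  have del1k: "sigma_del2 n (n - 3) \<mu> 1 k * u 1 * u k = Q * X * ((1 - p k) * v k)" if "k \<in> B" for k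
  proof -
    have "sigma_del2 n (n - 3) \<mu> 1 k = Q / \<mu> k * (t - 1 / \<mu> k)"
      using sigma_del2_first_eq[of k n \<mu>] nz n that by (simp add: Q_def t_def B_def)
    also have "\<dots> = Q / \<mu> k * (t - t * p k)" by (simp only: inv)
    finally have e: "sigma_del2 n (n - 3) \<mu> 1 k = Q / \<mu> k * (t - t * p k)" .
    show ?thesis unfolding e X_def v_def by (simp add: algebra_simps diff_divide_distrib)
  qed
  have sym: "sigma_del2 n (n - 3) \<mu> j k = sigma_del2 n (n - 3) \<mu> k j" for j k
    by (cases "j = k") (simp_all add: sigma_del2_def fun_upd_twist)
  have deljk: "sigma_del2 n (n - 3) \<mu> j k * u j * u k
      = Q * ((b - (b - 1) * p j - (b - 1) * p k) * v j * v k)"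
    if "j \<in> B" "k \<in> B" "j \<noteq> k" for j k
  proof -
    have "sigma_del2 n (n - 3) \<mu> j k = Q / (\<mu> j * \<mu> k) * (1 + \<mu> 1 * (t - 1 / \<mu> j - 1 / \<mu> k))"
      using sigma_del2_eq[of j n k \<mu>] nz that by (simp add: Q_def t_def B_def)
    also have "1 + \<mu> 1 * (t - 1 / \<mu> j - 1 / \<mu> k) = b - (b - 1) * p j - (b - 1) * p k"
      unfolding bm[symmetric] by (simp add: b_def algebra_simps)
    finally show ?thesis using posB that by (simp add: uv less_imp_neq[THEN not_sym])
  qed
  have A: "{1..n} = insert 1 B" using n by (auto simp: B_def)
  have off: "(\<Sum>j=1..n. \<Sum>k\<in>{1..n} - {j}. sigma_del2 n (n - 3) \<mu> j k * u j * u k)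
      = Q * (2 * X * (V - E) + b * V\<^sup>2 - 2 * (b - 1) * E * V
          - (\<Sum>j\<in>B. (b - 2 * (b - 1) * p j) * (v j)\<^sup>2))"
  proof -
    let ?c = "\<lambda>j k. sigma_del2 n (n - 3) \<mu> j k * u j * u k"
    let ?g = "\<lambda>j k. (b - (b - 1) * p j - (b - 1) * p k) * v j * v k"
    have row1: "(\<Sum>k\<in>B. ?c 1 k) = Q * X * (V - E)"
    proof -
      have "(\<Sum>k\<in>B. ?c 1 k) = (\<Sum>k\<in>B. Q * X * ((1 - p k) * v k))"
        using del1k by (intro sum.cong) auto
      also have "\<dots> = Q * X * (V - E)"
        by (simp add: V_def E_def left_diff_distrib sum_subtractf flip: sum_distrib_left)
      finally show ?thesis .
    qed
    have "(\<Sum>j\<in>B. \<Sum>k\<in>insert 1 B - {j}. ?c j k) = (\<Sum>j\<in>B. ?c 1 j + (\<Sum>k\<in>B - {j}. Q * ?g j k))"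
    proof (rule sum.cong[OF refl])
      fix j assume j: "j \<in> B"
      have "insert 1 B - {j} = insert 1 (B - {j})" using j nB by auto
      then have "(\<Sum>k\<in>insert 1 B - {j}. ?c j k) = ?c j 1 + (\<Sum>k\<in>B - {j}. ?c j k)"
        using nB by simp
      moreover have "(\<Sum>k\<in>B - {j}. ?c j k) = (\<Sum>k\<in>B - {j}. Q * ?g j k)"
        using deljk j by (intro sum.cong) auto
      moreover have "?c j 1 = ?c 1 j" unfolding sym[of j 1] by simp
      ultimately show "(\<Sum>k\<in>insert 1 B - {j}. ?c j k) = ?c 1 j + (\<Sum>k\<in>B - {j}. Q * ?g j k)"
        by linarith
    qed
    also have "\<dots> = Q * X * (V - E) + Q * (\<Sum>j\<in>B. (\<Sum>k\<in>B. ?g j k) - ?g j j)"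
      unfolding sum.distrib row1 using nB by (simp add: sum_diff1 flip: sum_distrib_left)
    finally have rest: "(\<Sum>j\<in>B. \<Sum>k\<in>insert 1 B - {j}. ?c j k)
      = Q * X * (V - E) + Q * (\<Sum>j\<in>B. (\<Sum>k\<in>B. ?g j k) - ?g j j)" .
    have "(\<Sum>k\<in>B. ?g j k) = (b * V - (b - 1) * E) * v j - (b - 1) * V * (p j * v j)" for j
    proof -
      have "(\<Sum>k\<in>B. ?g j k)
          = (\<Sum>k\<in>B. (b * v j - (b - 1) * (p j * v j)) * v k - (b - 1) * v j * (p k * v k))"
        by (intro sum.cong refl) (simp add: algebra_simps)
      also have "\<dots> = (b * v j - (b - 1) * (p j * v j)) * V - (b - 1) * v j * E"
        by (simp add: sum_subtractf V_def E_def sum_distrib_left)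
      finally show ?thesis by (simp add: algebra_simps)
    qed
    then have "(\<Sum>j\<in>B. \<Sum>k\<in>B. ?g j k) = (b * V - (b - 1) * E) * V - (b - 1) * V * E"
      by (simp add: sum_subtractf V_def E_def sum_distrib_left)
    moreover have "(\<Sum>j\<in>B. ?g j j) = (\<Sum>j\<in>B. (b - 2 * (b - 1) * p j) * (v j)\<^sup>2)"
      by (intro sum.cong refl) (simp add: power2_eq_square algebra_simps)
    moreover have "insert 1 B - {1} = B" using nB by auto
    ultimately show ?thesis
      unfolding A using nB rest
      by (simp add: row1[simplified] sum_subtractf) (simp add: power2_eq_square algebra_simps)
  qed
  have lin: "(\<Sum>j=1..n. sigma_del n (n - 2) \<mu> j * u j) = Q * (X + b * V - (b - 1) * E)"
  proof -
    have "(\<Sum>j\<in>B. sigma_del n (n - 2) \<mu> j * u j)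
        = (\<Sum>j\<in>B. Q * (b * v j - (b - 1) * (p j * v j)))"
      using posB by (intro sum.cong refl)
        (simp add: delj uv less_imp_neq[THEN not_sym], simp add: algebra_simps)
    also have "\<dots> = Q * (b * V - (b - 1) * E)"
      by (simp add: V_def E_def sum_subtractf flip: sum_distrib_left)
    finally show ?thesis
      unfolding A using nB by (simp add: del1[simplified] X_def algebra_simps)
  qed
  have last: "(1 - \<tau>) / \<mu> n * sigma_del n (n - 2) \<mu> n * (u n)\<^sup>2
      = Q * ((1 - \<tau>) * ((b - (b - 1) * p n) * (v n)\<^sup>2))"
    using \<mu>n nB by (simp add: delj uv power2_eq_square)
  have diag: "(\<Sum>j=1..n - 1. sigma_del n (n - 2) \<mu> j * (u j)\<^sup>2 / (\<mu> n + \<epsilon> - \<mu> j))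
      = Q * (X\<^sup>2 * p n / (1 + \<eta> - (b - 1) * p n)
        + (\<Sum>j\<in>B - {n}. (b - (b - 1) * p j) * (v j)\<^sup>2 * p n / ((1 + \<eta>) * p j - p n)))"
  proof -
    have "{1..n - 1} = insert 1 (B - {n})" using n by (auto simp: B_def)
    moreover have "sigma_del n (n - 2) \<mu> 1 * (u 1)\<^sup>2 / (\<mu> n + \<epsilon> - \<mu> 1)
        = Q * (X\<^sup>2 * p n / (1 + \<eta> - (b - 1) * p n))"
    proof -
      have d: "\<mu> n + \<epsilon> - \<mu> 1 > 0" using le_n[of 1] \<epsilon> n by simp
      have "1 + \<eta> - (b - 1) * p n = (\<mu> n + \<epsilon> - \<mu> 1) / \<mu> n"
        using \<mu>n by (simp add: \<eta>_def diff_divide_distrib add_divide_distrib flip: bm)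
      then show ?thesis
        using d \<mu>n t by (simp add: del1[simplified] X_def p_def power2_eq_square)
    qed
    moreover have "sigma_del n (n - 2) \<mu> j * (u j)\<^sup>2 / (\<mu> n + \<epsilon> - \<mu> j)
        = Q * ((b - (b - 1) * p j) * (v j)\<^sup>2 * p n / ((1 + \<eta>) * p j - p n))"
      if "j \<in> B" for j
    proof -
      have \<mu>j: "\<mu> j > 0" by (rule posB[OF that])
      have d: "\<mu> n + \<epsilon> - \<mu> j > 0" using le_n[of j] that \<epsilon> n by (simp add: B_def)
      have "(1 + \<eta>) * p j - p n = (\<mu> n + \<epsilon> - \<mu> j) / (t * \<mu> j * \<mu> n)"
        using \<mu>n \<mu>j t by (simp add: \<eta>_def p_def field_simps)
      then have "p n / ((1 + \<eta>) * p j - p n) = \<mu> j / (\<mu> n + \<epsilon> - \<mu> j)"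
        using \<mu>n \<mu>j t d by (simp add: p_def)
      moreover have "sigma_del n (n - 2) \<mu> j * (u j)\<^sup>2 = Q * ((b - (b - 1) * p j) * (v j)\<^sup>2) * \<mu> j"
        using \<mu>j that by (simp add: delj uv power2_eq_square)
      ultimately show ?thesis by (metis times_divide_eq_right mult.assoc)
    qed
    ultimately show ?thesis using nB by (simp add: distrib_left sum_distrib_left)
  qed
  have one: "sum p B = 1"
  proof -
    have "sum p B = (\<Sum>j\<in>B. 1 / \<mu> j / t)" by (simp add: p_def mult.commute)
    also have "\<dots> = t / t" unfolding t_def B_def by (simp only: sum_divide_distrib)
    finally show ?thesis using t by simp
  qed
  have "0 \<le> (X + E)\<^sup>2 / b + (b - 2) * E\<^sup>2 + (\<Sum>j\<in>B. (b - 2 * (b - 1) * p j) * (v j)\<^sup>2)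
    + (1 - \<tau>) * (X\<^sup>2 * p n / (1 + \<eta> - (b - 1) * p n)
        + (\<Sum>j\<in>B - {n}. (b - (b - 1) * p j) * (v j)\<^sup>2 * p n / ((1 + \<eta>) * p j - p n))
        - (b - (b - 1) * p n) * (v n)\<^sup>2)"
    unfolding E_def
  proof (rule normalized_form_nonneg[where a = 2])
    show "p j \<le> p 2" if "j \<in> B" for j
    proof -
      have "\<mu> 2 \<le> \<mu> j" using mono_onD[OF mono, of 2 j] that n by (auto simp: B_def)
      then show ?thesis using posB nB t by (simp add: p_def frac_le)
    qed
    show "p n \<le> p j" if "j \<in> B" for j
      using le_n[of j] posB[OF that] that t by (simp add: p_def frac_le B_def)
    show "b \<le> 1 + 1 / p 2"
    proof -
      have "\<mu> 1 \<le> \<mu> 2" using mono_onD[OF mono, of 1 2] n by auto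
      then show ?thesis using t by (simp add: b_def p_def mult.commute)
    qed
    show "p n \<le> \<tau> * p 2 \<or> b \<le> \<tau> / 8 * p n"
      using dich
    proof
      assume "\<mu> 2 \<le> \<tau> * \<mu> n"
      then have "p n \<le> \<tau> * p 2" using posB[OF nB(2)] \<mu>n t by (simp add: p_def field_simps)
      then show ?thesis ..
    next
      assume "sigma n (n - 1) \<mu> / Q \<le> \<tau> / 8 * (1 / (t * \<mu> n))"
      then have "b \<le> \<tau> / 8 * p n" using Q unfolding sb p_def by simp
      then show ?thesis ..
    qed
  qed (use nB p one \<tau> \<epsilon> \<mu>n b in \<open>auto simp: \<eta>_def\<close>)
  also have "\<dots> = - (2 * X * (V - E) + b * V\<^sup>2 - 2 * (b - 1) * E * V
          - (\<Sum>j\<in>B. (b - 2 * (b - 1) * p j) * (v j)\<^sup>2))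
      + 1 / b * (X + b * V - (b - 1) * E)\<^sup>2
      + (1 - \<tau>) * (X\<^sup>2 * p n / (1 + \<eta> - (b - 1) * p n)
        + (\<Sum>j\<in>B - {n}. (b - (b - 1) * p j) * (v j)\<^sup>2 * p n / ((1 + \<eta>) * p j - p n))
        - (b - (b - 1) * p n) * (v n)\<^sup>2)"
  proof -
    have "(X + E)\<^sup>2 / b + (b - 2) * E\<^sup>2 = - (2 * X * (V - E) + b * V\<^sup>2 - 2 * (b - 1) * E * V)
        + 1 / b * (X + b * V - (b - 1) * E)\<^sup>2"
      using b by (simp add: field_simps) (simp add: power2_eq_square algebra_simps)
    then show ?thesis by simp
  qed
  finally have base: "0 \<le> Q * \<dots>" using Q by (intro mult_nonneg_nonneg) auto
  \<comment> \<open>\<open>base\<close> contains the squared linear form once, the claim \<open>n\<^sup>2\<close> times.\<close>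
  have "1 \<le> (real n)\<^sup>2" using n by simp
  then have "1 * (Q / b * (X + b * V - (b - 1) * E)\<^sup>2)
      \<le> (real n)\<^sup>2 * (Q / b * (X + b * V - (b - 1) * E)\<^sup>2)"
    using Q b by (intro mult_right_mono) auto
  also have "\<dots> = (real n)\<^sup>2 / (Q * b) * (Q * (X + b * V - (b - 1) * E))\<^sup>2"
    using Q by (simp add: power2_eq_square)
  finally have big: "Q / b * (X + b * V - (b - 1) * E)\<^sup>2
      \<le> (real n)\<^sup>2 / (Q * b) * (Q * (X + b * V - (b - 1) * E))\<^sup>2" by simp
  show ?thesis
    using base big unfolding off last lin diag sb by (simp add: algebra_simps)
qed

section \<open>Complex vectors and the choice of the bound\<close>

text \<open>
  If \<open>\<mu>\<^sub>2 > \<tau> \<mu>\<^sub>n\<close>, then every \<open>\<mu>\<^sub>j\<close> with \<open>j \<ge> 2\<close> exceeds \<open>\<tau> \<mu>\<^sub>n\<close>. Thus the product is at least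
  \<open>(\<tau> \<mu>\<^sub>n)\<^bsup>n-1\<^esup> \<ge> \<tau> \<mu>\<^sub>n\<close>, whereas \<open>\<mu>\<^sub>n \<Sum> 1/\<mu>\<^sub>j \<le> (n - 1)/\<tau>\<close> is bounded independently of \<open>\<mu>\<close>.
\<close>

lemma second_entry_small_or_b_small:
  fixes \<mu> :: "nat \<Rightarrow> real" and \<tau> :: real
  assumes n: "n \<ge> 2" and mono: "mono_on {1..n} \<mu>" and \<mu>2: "\<mu> 2 > 0" and \<tau>: "0 < \<tau>"
    and s: "sigma n (n - 1) \<mu> > 0" and big1: "1 \<le> \<tau> * \<mu> n"
    and big2: "8 * real (n - 1) / \<tau>\<^sup>2 * sigma n (n - 1) \<mu> \<le> \<tau> * \<mu> n"
  shows "\<mu> 2 \<le> \<tau> * \<mu> n \<or> sigma n (n - 1) \<mu> / (\<Prod>j\<in>{2..n}. \<mu> j)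
    \<le> \<tau> / 8 * (1 / ((\<Sum>j\<in>{2..n}. 1 / \<mu> j) * \<mu> n))"
proof (cases "\<mu> 2 \<le> \<tau> * \<mu> n")
  case False
  then have ge: "\<tau> * \<mu> n \<le> \<mu> j" if "j \<in> {2..n}" for j
    using mono_onD[OF mono, of 2 j] that by auto
  have \<mu>n: "\<mu> n > 0" using mono_onD[OF mono, of 2 n] \<mu>2 n by auto
  have x: "\<tau> * \<mu> n > 0" using \<tau> \<mu>n by simp
  define Q where "Q = (\<Prod>j\<in>{2..n}. \<mu> j)"
  define t where "t = (\<Sum>j\<in>{2..n}. 1 / \<mu> j)"
  have pos: "\<mu> j > 0" if "j \<in> {2..n}" for j using ge[OF that] x by linarith
  have t: "t > 0" unfolding t_def by (rule sum_pos) (use pos n in auto)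
  have "\<tau> * \<mu> n = (\<tau> * \<mu> n) ^ 1" by simp
  also have "\<dots> \<le> (\<tau> * \<mu> n) ^ (n - 1)" using big1 n by (intro power_increasing) auto
  also have "\<dots> = (\<Prod>j\<in>{2..n}. \<tau> * \<mu> n)" by (simp add: Suc_diff_le numeral_2_eq_2)
  also have "\<dots> \<le> Q" unfolding Q_def using ge x by (intro prod_mono) auto
  finally have Q: "\<tau> * \<mu> n \<le> Q" .
  have "t \<le> (\<Sum>j\<in>{2..n}. 1 / (\<tau> * \<mu> n))"
    unfolding t_def using ge x by (intro sum_mono divide_left_mono) (auto simp: pos)
  also have "\<dots> = real (n - 1) / (\<tau> * \<mu> n)" by (simp add: Suc_diff_le numeral_2_eq_2)
  finally have "t * \<mu> n \<le> real (n - 1) / \<tau>" using x \<mu>n \<tau> by (simp add: field_simps)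
  then have "8 / \<tau> * (t * \<mu> n) \<le> 8 / \<tau> * (real (n - 1) / \<tau>)"
    using \<tau> by (intro mult_left_mono) auto
  then have "8 / \<tau> * (t * \<mu> n) * sigma n (n - 1) \<mu> \<le> 8 * real (n - 1) / \<tau>\<^sup>2 * sigma n (n - 1) \<mu>"
    using s by (intro mult_right_mono) (auto simp: power2_eq_square)
  also have "\<dots> \<le> Q" using big2 Q by linarith
  finally have "8 / \<tau> * (t * \<mu> n) * sigma n (n - 1) \<mu> \<le> Q" .
  then have "sigma n (n - 1) \<mu> / Q \<le> \<tau> / 8 * (1 / (t * \<mu> n))"
    using \<tau> t \<mu>n x less_le_trans[OF x Q] by (simp add: field_simps)
  then show ?thesis unfolding Q_def t_def by (rule disjI2)
qed simp

lemma Re_hermitian_sum: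
  fixes c :: "nat \<Rightarrow> nat \<Rightarrow> real" and w :: "nat \<Rightarrow> complex"
  shows "Re (\<Sum>j\<in>A. \<Sum>k\<in>B j. of_real (c j k) * w j * cnj (w k))
    = (\<Sum>j\<in>A. \<Sum>k\<in>B j. c j k * Re (w j) * Re (w k))
      + (\<Sum>j\<in>A. \<Sum>k\<in>B j. c j k * Im (w j) * Im (w k))"
  by (simp add: algebra_simps flip: sum.distrib)

lemma cmod_real_combination_squared:
  fixes d :: "nat \<Rightarrow> real" and w :: "nat \<Rightarrow> complex"
  shows "(cmod (\<Sum>j\<in>A. of_real (d j) * w j))\<^sup>2
    = (\<Sum>j\<in>A. d j * Re (w j))\<^sup>2 + (\<Sum>j\<in>A. d j * Im (w j))\<^sup>2"
  by (simp add: cmod_power2)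

theorem theorem4p3:
  fixes n :: nat and \<tau> \<epsilon> s :: real
  assumes "n \<ge> 3" and "0 < \<tau>" and "\<tau> \<le> 1 / 2" and "\<epsilon> > 0"
  shows "\<exists>M>0. \<forall>\<mu>\<in>Gamma_cone n (n - 1).
    mono_on {1..n} \<mu> \<longrightarrow> sigma n (n - 1) \<mu> = s \<longrightarrow> \<mu> n \<ge> M \<longrightarrow>
    (\<forall>w :: nat \<Rightarrow> complex.
      - Re (\<Sum>j=1..n. \<Sum>k\<in>{1..n} - {j}. of_real (sigma_del2 n (n - 3) \<mu> j k) * w j * cnj (w k))
        - (1 - \<tau>) / \<mu> n * sigma_del n (n - 2) \<mu> n * (cmod (w n))\<^sup>2
      \<ge> - ((real n)\<^sup>2 / sigma n (n - 1) \<mu>)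
            * (cmod (\<Sum>j=1..n. of_real (sigma_del n (n - 2) \<mu> j) * w j))\<^sup>2
        - (1 - \<tau>) * (\<Sum>j=1..n - 1. sigma_del n (n - 2) \<mu> j * (cmod (w j))\<^sup>2 / (\<mu> n + \<epsilon> - \<mu> j)))"
proof -
  \<comment> \<open>The three summands of \<open>\<tau> * M\<close> give \<open>\<tau> * \<mu> n \<ge> 1\<close>, \<open>\<epsilon> / \<mu> n \<le> \<tau> / 4\<close> and the bound on
     \<open>\<sigma>\<^sub>n\<^sub>-\<^sub>1(\<mu>)\<close> in \<open>second_entry_small_or_b_small\<close>.\<close>
  define K where "K = 8 * real (n - 1) / \<tau>\<^sup>2 * \<bar>s\<bar>"
  define M where "M = (1 + 4 * \<epsilon> + K) / \<tau>"
  have K: "K \<ge> 0" by (simp add: K_def)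
  have M: "M > 0" using K assms by (simp add: M_def add_pos_nonneg)
  show ?thesis
  proof (intro exI[of _ M] conjI ballI impI allI M)
    fix \<mu> :: "nat \<Rightarrow> real" and w :: "nat \<Rightarrow> complex"
    assume G: "\<mu> \<in> Gamma_cone n (n - 1)" and mono: "mono_on {1..n} \<mu>"
      and s: "sigma n (n - 1) \<mu> = s" and "M \<le> \<mu> n"
    then have big: "1 + 4 * \<epsilon> + K \<le> \<tau> * \<mu> n"
      using assms by (simp add: M_def pos_divide_le_eq mult.commute)
    have \<mu>n: "\<mu> n > 0" using M \<open>M \<le> \<mu> n\<close> by linarith
    have \<mu>2: "\<mu> 2 > 0" using Gamma_cone_second_pos[OF _ G mono] assms by simp
    have pos: "\<mu> j > 0" if "j \<in> {2..n}" for j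
      using mono_onD[OF mono, of 2 j] \<mu>2 that by auto
    have spos: "sigma n (n - 1) \<mu> > 0" using G assms by (auto simp: Gamma_cone_def)
    have "4 * \<epsilon> \<le> \<tau> * \<mu> n" using big K by linarith
    then have eps: "\<epsilon> / \<mu> n \<le> \<tau> / 4" using \<mu>n by (simp add: pos_divide_le_eq)
    have "1 \<le> \<tau> * \<mu> n" using big K assms by linarith
    moreover have "K \<le> \<tau> * \<mu> n" using big assms by linarith
    then have "8 * real (n - 1) / \<tau>\<^sup>2 * sigma n (n - 1) \<mu> \<le> \<tau> * \<mu> n"
      using spos unfolding K_def s by simp
    ultimately have dich: "\<mu> 2 \<le> \<tau> * \<mu> n \<or> sigma n (n - 1) \<mu> / (\<Prod>j\<in>{2..n}. \<mu> j)
        \<le> \<tau> / 8 * (1 / ((\<Sum>j\<in>{2..n}. 1 / \<mu> j) * \<mu> n))"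
      using second_entry_small_or_b_small[OF _ mono \<mu>2 _ spos] assms by simp
    note real = real_form_inequality[OF assms(1) pos mono assms(2,3,4) eps spos dich]
    show "- Re (\<Sum>j=1..n. \<Sum>k\<in>{1..n} - {j}. of_real (sigma_del2 n (n - 3) \<mu> j k) * w j * cnj (w k))
        - (1 - \<tau>) / \<mu> n * sigma_del n (n - 2) \<mu> n * (cmod (w n))\<^sup>2
      \<ge> - ((real n)\<^sup>2 / sigma n (n - 1) \<mu>)
            * (cmod (\<Sum>j=1..n. of_real (sigma_del n (n - 2) \<mu> j) * w j))\<^sup>2
        - (1 - \<tau>) * (\<Sum>j=1..n - 1. sigma_del n (n - 2) \<mu> j * (cmod (w j))\<^sup>2 / (\<mu> n + \<epsilon> - \<mu> j))"
      using real[of "\<lambda>j. Re (w j)"] real[of "\<lambda>j. Im (w j)"]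
      unfolding Re_hermitian_sum cmod_real_combination_squared cmod_power2
      by (simp add: distrib_left add_divide_distrib sum.distrib)
  qed
qed

end
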